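(* Let $b$ be an odd integer with $3\le b\le 10^6$ and let $q$ be an odd prime with $q>\log_2(b+1)$. Then there are no integers $k, y\ge 2$ such that $$(2^{k}-1)(b^{k}-1)=y^{q},$$ except possibly when the pair $(b,q)$ is one of the following: (i) $q=5$ and $b\in\{15,17\}$; (ii) $q=11$ and $b\in\{1023,1025\}$; (iii) $q=13$ and $b\in\{4095,4097\}$; (iv) $q=17$ and $b=t\cdot 2^{14}+1$ or $b=t\cdot 2^{14}-1$ for some $t\in\{1,2,3,4,5,6,7\}$. *)

theory Defs
  imports Complex_Main "HOL-Computational_Algebra.Primes"
begin

end

theory Submission
  imports Defs "HOL-Number_Theory.Number_Theory"
begin

text \<open>
  Since \<open>b - 1 < 2\<^sup>q\<close>, the 2-adic valuation of \<open>y\<^sup>q\<close> forces \<open>k\<close> to be even, and in fact divisible by a large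
  power of 2. If \<open>p\<close> is an odd prime with \<open>p - 1\<close> dividing \<open>k\<close>, then \<open>p\<close> divides \<open>2\<^sup>k - 1\<close>, so the valuations
  of \<open>2\<^sup>k - 1\<close> and \<open>b\<^sup>k - 1\<close> at \<open>p\<close> add up to at least \<open>q\<close>. By lifting the exponent this sum is at most
  twice the valuation of \<open>k\<close> plus the Fermat depths of 2 and \<open>b\<close>, the valuations at \<open>p\<close> of \<open>x\<close> to the power
  \<open>p - 1\<close> minus 1. As the depths are small, high powers of \<open>p\<close> divide \<open>k\<close>, and this cascades from
  prime to prime until \<open>q - 1\<close> and then \<open>q\<close> itself divide \<open>k\<close>. But then, for \<open>X = 2\<^sup>j\<close>, \<open>Y = b\<^sup>j\<close> and \<open>j = k / q\<close>, the
  product of \<open>X\<^sup>q - 1\<close> and \<open>Y\<^sup>q - 1\<close> is a \<open>q\<close>-th power, which a Pade approximation to the \<open>q\<close>-th root of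
  \<open>1 - 1 / X\<^sup>q\<close> excludes. The excepted pairs are those where 2 divides \<open>k\<close> too rarely for the cascade.

  The depth of \<open>b\<close> at \<open>q\<close> is bounded by the size of the factors of \<open>b\<close> to the power \<open>q - 1\<close> minus 1 for
  most primes. For the remaining ones one has to know that no number between 2 and \<open>10\<^sup>6\<close> is a root of unity
  modulo a small power of \<open>q\<close>, which is checked on the powers of one Teichmueller lift.
\<close>

section \<open>Lifting the exponent\<close>

lemma prime_not_dvd_geometric_sum:
  fixes x :: int
  assumes "prime p" "int p dvd x - 1" "\<not> p dvd m"
  shows "\<not> int p dvd (\<Sum>i<m. x ^ i)"
proof -
  have x: "[x = 1] (mod int p)" using assms(2) by (simp add: cong_iff_dvd_diff)
  have "[(\<Sum>i<m. x ^ i) = (\<Sum>i<m. 1 ^ i)] (mod int p)"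
    by (intro cong_sum cong_pow x)
  hence "[(\<Sum>i<m. x ^ i) = int m] (mod int p)" by simp
  thus ?thesis using assms(3) by (metis cong_dvd_iff int_dvd_int_iff)
qed

lemma multiplicity_power_diff_one_coprime:
  fixes x :: int
  assumes "prime p" "int p dvd x - 1" "\<not> p dvd m" "x \<ge> 2"
  shows "multiplicity (int p) (x ^ m - 1) = multiplicity (int p) (x - 1)"
proof -
  have p: "prime (int p)" using assms by simp
  have "x ^ m - 1 = (x - 1) * (\<Sum>i<m. x ^ i)" by (rule power_diff_1_eq)
  moreover have nd: "\<not> int p dvd (\<Sum>i<m. x ^ i)"
    by (rule prime_not_dvd_geometric_sum[OF assms(1-3)])
  moreover have "(\<Sum>i<m. x ^ i) \<noteq> 0" using nd by auto
  ultimately have "multiplicity (int p) (x ^ m - 1)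
      = multiplicity (int p) (x - 1) + multiplicity (int p) (\<Sum>i<m. x ^ i)"
    using p assms(4) by (simp add: prime_elem_multiplicity_mult_distrib)
  thus ?thesis using nd by (simp add: not_dvd_imp_multiplicity_0)
qed

text \<open>The cofactor of \<open>x - 1\<close> is \<open>p\<close> modulo \<open>p^2\<close>: to
  first order \<open>x ^ i\<close> is \<open>1 + i p t\<close>, and for odd \<open>p\<close> the sum
  of the \<open>i\<close> is a multiple of \<open>p\<close>. For \<open>p = 2\<close> the cofactor
  is \<open>x + 1\<close>, and \<open>4 dvd x - 1\<close> is used instead.\<close>

lemma multiplicity_power_prime_diff_one:
  fixes x :: int
  assumes "prime p" "int p dvd x - 1" "p = 2 \<Longrightarrow> 4 dvd x - 1" "x \<ge> 2"
  shows "multiplicity (int p) (x ^ p - 1) = multiplicity (int p) (x - 1) + 1"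
proof -
  have p: "prime (int p)" using assms by simp
  obtain t where t: "x = 1 + int p * t" using assms(2) by (metis dvd_def diff_add_cancel add.commute)
  have S: "[(\<Sum>i<p. x ^ i) = int p] (mod (int p)^2)"
  proof (cases "p = 2")
    case True
    have "4 dvd x - 1" using assms(3) True by blast
    thus ?thesis unfolding True by (simp add: lessThan_nat_numeral cong_iff_dvd_diff)
  next
    case False
    hence "odd p" using assms(1) prime_odd_nat prime_gt_1_nat by (metis primes_dvd_imp_eq two_is_prime_nat)
    have pw: "[x ^ i = 1 + int i * (int p * t)] (mod (int p)^2)" for i
    proof (induction i)
      case (Suc i)
      have "[x ^ Suc i = (1 + int p * t) * (1 + int i * (int p * t))] (mod (int p)^2)"
        using cong_scalar_left[OF Suc, of x] t by simp
      also have "(1 + int p * t) * (1 + int i * (int p * t))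
          = 1 + int (Suc i) * (int p * t) + (int p)^2 * (int i * t^2)"
        by (simp add: algebra_simps power2_eq_square)
      also have "[\<dots> = 1 + int (Suc i) * (int p * t)] (mod (int p)^2)"
        by (simp add: cong_iff_dvd_diff)
      finally show ?case .
    qed simp
    have "[(\<Sum>i<p. x ^ i) = (\<Sum>i<p. 1 + int i * (int p * t))] (mod (int p)^2)"
      by (intro cong_sum pw)
    also have "(\<Sum>i<p. 1 + int i * (int p * t)) = int p + (int p * t) * (\<Sum>i<p. int i)"
      by (simp add: sum.distrib sum_distrib_left mult_ac)
    also have "(\<Sum>i<p. int i) = int p * ((int p - 1) div 2)"
    proof -
      have "2 * (\<Sum>i<n. int i) = int n * (int n - 1)" for n
        by (induction n) (auto simp: algebra_simps)
      moreover have "2 * ((int p - 1) div 2) = int p - 1" using \<open>odd p\<close> by simp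
      ultimately show ?thesis
        by (metis mult.left_commute mult_cancel_left zero_neq_numeral)
    qed
    also have "[int p + int p * t * (int p * ((int p - 1) div 2)) = int p] (mod (int p)^2)"
      by (simp add: cong_iff_dvd_diff power2_eq_square mult_ac)
    finally show ?thesis .
  qed
  have eq: "x ^ p - 1 = (x - 1) * (\<Sum>i<p. x ^ i)" by (rule power_diff_1_eq)
  have p1: "int p > 1" using assms(1) prime_gt_1_nat by auto
  have d1: "int p ^ 1 dvd (\<Sum>i<p. x ^ i)"
    using S by (metis cong_dvd_modulus cong_dvd_iff dvd_refl power2_eq_square dvd_triv_left power_one_right)
  have d2: "\<not> int p ^ Suc 1 dvd (\<Sum>i<p. x ^ i)"
  proof
    assume "int p ^ Suc 1 dvd (\<Sum>i<p. x ^ i)"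
    hence "(int p)^2 dvd int p" using S cong_dvd_iff by (metis Suc_1)
    thus False using p1 by (simp add: power2_eq_square)
  qed
  have "multiplicity (int p) (\<Sum>i<p. x ^ i) = 1" by (rule multiplicity_eqI[OF d1 d2])
  moreover have "(\<Sum>i<p. x ^ i) \<noteq> 0" using d2 by auto
  ultimately show ?thesis unfolding eq using p assms(4)
    by (subst prime_elem_multiplicity_mult_distrib) auto
qed

text \<open>Passing from \<open>x\<close> to \<open>x ^ p\<close> strips one factor \<open>p\<close>
  from \<open>n\<close> and adds 1 to the valuation, until the coprime case remains.\<close>

lemma multiplicity_power_diff_one:
  fixes x :: int
  assumes "prime p" "int p dvd x - 1" "p = 2 \<Longrightarrow> 4 dvd x - 1" "x \<ge> 2" "n > 0"
  shows "multiplicity (int p) (x ^ n - 1) = multiplicity (int p) (x - 1) + multiplicity p n"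
  using assms(2-)
proof (induction n arbitrary: x rule: less_induct)
  case (less n)
  show ?case
  proof (cases "p dvd n")
    case False
    thus ?thesis using multiplicity_power_diff_one_coprime[OF assms(1) less.prems(1) False] less.prems
      by (simp add: not_dvd_imp_multiplicity_0)
  next
    case True
    then obtain m where m: "n = p * m" by auto
    have p1: "p > 1" using assms(1) prime_gt_1_nat by blast
    have m0: "m > 0" "m < n" using m less.prems p1 by auto
    have dv: "x - 1 dvd x ^ p - 1" by (simp add: power_diff_1_eq)
    have xp: "x ^ p \<ge> 2" using less.prems(3) p1 self_le_power[of x p] by linarith
    have "multiplicity (int p) ((x ^ p) ^ m - 1) = multiplicity (int p) (x ^ p - 1) + multiplicity p m"
      by (rule less.IH[OF m0(2) _ _ xp m0(1)]) (use dv less.prems dvd_trans in blast)+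
    moreover have "multiplicity p n = multiplicity p m + 1"
      unfolding m using assms(1) m0 p1 by (subst prime_elem_multiplicity_mult_distrib) auto
    moreover have "multiplicity (int p) (x ^ p - 1) = multiplicity (int p) (x - 1) + 1"
      by (rule multiplicity_power_prime_diff_one[OF assms(1) less.prems(1-3)])
    ultimately show ?thesis by (simp add: m power_mult)
  qed
qed

section \<open>Valuations of a solution\<close>

text \<open>For a prime \<open>p\<close> not dividing \<open>x \<ge> 2\<close> this is one more than
  the valuation of the Fermat quotient; for \<open>p\<close> dividing \<open>x\<close> it is
  0.\<close>

definition fermat_depth :: "nat \<Rightarrow> int \<Rightarrow> nat" where
  "fermat_depth p x = multiplicity (int p) (x ^ (p - 1) - 1)"

lemma power_ge_two:
  fixes x :: int
  assumes "x \<ge> 2" "n > 0"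
  shows "x ^ n \<ge> 2"
  using assms self_le_power[of x n] by linarith

lemma fermat_dvd:
  fixes x :: int
  assumes "prime p" "\<not> int p dvd x"
  shows "int p dvd x ^ (p - 1) - 1"
proof -
  define a where "a = nat (x mod int p)"
  have p0: "int p > 0" using assms(1) prime_gt_0_nat by simp
  hence a: "int a = x mod int p" by (simp add: a_def)
  have "\<not> p dvd a"
    using assms(2) a by (metis dvd_mod_iff dvd_refl int_dvd_int_iff)
  hence "[int (a ^ (p - 1)) = int 1] (mod int p)"
    using fermat_theorem[OF assms(1)] by (simp only: cong_int_iff)
  hence "[(x mod int p) ^ (p - 1) = 1] (mod int p)" by (simp add: a)
  hence "[x ^ (p - 1) = 1] (mod int p)" by (simp add: cong_def power_mod)
  thus ?thesis by (simp add: cong_iff_dvd_diff)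
qed

text \<open>An inequality, so that \<open>p\<close> may divide \<open>x\<close>: then the left side
  is 0. Otherwise the exponent is lifted from \<open>x ^ (p - 1)\<close>.\<close>

lemma multiplicity_power_diff_one_le:
  fixes x :: int
  assumes "prime p" "odd p" "(p - 1) dvd k" "k > 0" "x \<ge> 2"
  shows "multiplicity (int p) (x ^ k - 1) \<le> fermat_depth p x + multiplicity p k"
proof (cases "int p dvd x")
  case True
  have "\<not> int p dvd x ^ k - 1"
  proof
    assume *: "int p dvd x ^ k - 1"
    have "int p dvd x ^ k" using True assms(4) by (meson dvd_power dvd_trans)
    with * have "int p dvd 1" by (metis dvd_diff_right_iff dvd_diff_commute)
    thus False using assms(1) prime_gt_1_nat by fastforce
  qed
  thus ?thesis by (simp add: not_dvd_imp_multiplicity_0)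
next
  case False
  obtain j where j: "k = (p - 1) * j" using assms(3) by auto
  have p2: "p > 2" using assms(1,2) prime_gt_1_nat[of p] by (cases "p = 2") auto
  have j0: "j > 0" using j assms(4) by auto
  have "multiplicity (int p) ((x ^ (p - 1)) ^ j - 1)
      = multiplicity (int p) (x ^ (p - 1) - 1) + multiplicity p j"
    by (rule multiplicity_power_diff_one[OF assms(1) fermat_dvd[OF assms(1) False] _ _ j0])
      (use assms p2 power_ge_two in auto)
  moreover have "multiplicity p j \<le> multiplicity p k"
    using j assms(4) by (intro dvd_imp_multiplicity_le) auto
  ultimately show ?thesis by (simp add: j power_mult fermat_depth_def)
qed

section \<open>Divisibility conditions on the exponent of a solution\<close>

locale solution =
  fixes b y :: int and k q :: nat
  assumes odd_b: "odd b" and b_ge: "3 \<le> b"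
    and prime_q: "prime q" and odd_q: "odd q" and b_less: "b + 1 < 2 ^ q"
    and k_ge: "2 \<le> k" and y_ge: "2 \<le> y" and eq: "(2 ^ k - 1) * (b ^ k - 1) = y ^ q"
begin

lemma q_ge: "q \<ge> 3"
  using prime_q odd_q prime_ge_2_nat[of q] by (cases "q = 2") auto

lemma multiplicity_eq:
  assumes "prime p"
  shows "multiplicity (int p) (2 ^ k - 1) + multiplicity (int p) (b ^ k - 1) = q * multiplicity (int p) y"
proof -
  have p: "prime_elem (int p)" using assms by simp
  have "(2::int) ^ k - 1 \<noteq> 0" "b ^ k - 1 \<noteq> 0"
    using power_ge_two[of 2 k] power_ge_two[of b k] k_ge b_ge by auto
  hence "multiplicity (int p) (y ^ q) = multiplicity (int p) (2 ^ k - 1) + multiplicity (int p) (b ^ k - 1)"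
    unfolding eq[symmetric] by (rule prime_elem_multiplicity_mult_distrib[OF p])
  thus ?thesis using prime_elem_multiplicity_power_distrib[OF p, of y q] y_ge by simp
qed

lemma q_le_multiplicities:
  assumes "prime p" "int p dvd (2 ^ k - 1) * (b ^ k - 1)"
  shows "q \<le> multiplicity (int p) (2 ^ k - 1) + multiplicity (int p) (b ^ k - 1)"
proof -
  have p: "prime (int p)" using assms by simp
  have "int p dvd y" using assms eq p prime_dvd_power by metis
  hence "multiplicity (int p) y \<ge> 1"
    using p y_ge by (intro multiplicity_geI) (auto simp: not_prime_unit)
  thus ?thesis using multiplicity_eq[OF assms(1)] by simp
qed

text \<open>Since \<open>p - 1\<close> divides \<open>k\<close>, the prime \<open>p\<close> divides
  \<open>2 ^ k - 1\<close>, hence \<open>y\<close>, and the valuation of \<open>y ^ q\<close> is at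
  least \<open>q\<close>. The valuation of \<open>k\<close> enters once for each factor.\<close>

lemma q_le_depths:
  assumes "prime p" "odd p" "(p - 1) dvd k"
  shows "q \<le> fermat_depth p 2 + fermat_depth p b + 2 * multiplicity p k"
proof -
  have "\<not> int p dvd 2" using assms(1,2) by (metis int_dvd_int_iff of_nat_numeral primes_dvd_imp_eq two_is_prime_nat even_numeral)
  hence "int p dvd 2 ^ (p - 1) - 1" by (rule fermat_dvd[OF assms(1)])
  moreover obtain j where j: "k = (p - 1) * j" using assms(3) by auto
  have "(2::int) ^ (p - 1) - 1 dvd 2 ^ k - 1" unfolding j power_mult
    by (subst (2) power_diff_1_eq) simp
  ultimately have "int p dvd (2 ^ k - 1) * (b ^ k - 1)" by (meson dvd_mult2 dvd_trans)
  from q_le_multiplicities[OF assms(1) this] show ?thesis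
    using multiplicity_power_diff_one_le[OF assms, of 2] multiplicity_power_diff_one_le[OF assms, of b] k_ge b_ge
    by linarith
qed

text \<open>One step of the cascade: were the valuation of \<open>k\<close> less than
  \<open>v\<close>, the bound of \<open>q_le_depths\<close> would fall short of
  \<open>q\<close>.\<close>

lemma prime_power_dvd_exponent:
  assumes "prime p" "odd p" "(p - 1) dvd k" "fermat_depth p 2 + fermat_depth p b + 2 * (v - 1) < q"
  shows "p ^ v dvd k"
proof -
  have "v \<le> multiplicity p k" using q_le_depths[OF assms(1-3)] assms(4) by linarith
  thus ?thesis by (rule multiplicity_dvd')
qed

lemma two_multiplicities: "q \<le> multiplicity 2 (b ^ k - 1)"
proof -
  have "even (b ^ k - 1)" using odd_b by simp
  moreover have "odd ((2::int) ^ k - 1)" using k_ge by simp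
  ultimately show ?thesis using q_le_multiplicities[of 2] by (simp add: not_dvd_imp_multiplicity_0)
qed

text \<open>For odd \<open>k\<close> the geometric sum is odd, so \<open>2 ^ q\<close> would divide
  \<open>b - 1\<close>, which is positive and smaller.\<close>

lemma even_k: "even k"
proof (rule ccontr)
  assume "odd k"
  have "odd (\<Sum>i<k. b ^ i)"
    using prime_not_dvd_geometric_sum[of 2 b k] odd_b \<open>odd k\<close> by simp
  moreover have "2 ^ q dvd (b - 1) * (\<Sum>i<k. b ^ i)"
    using multiplicity_dvd'[OF two_multiplicities] by (simp add: power_diff_1_eq)
  ultimately have "2 ^ q dvd b - 1"
    by (simp add: coprime_dvd_mult_left_iff)
  thus False using zdvd_imp_le[of "2 ^ q" "b - 1"] b_ge b_less by simp
qed

text \<open>Lifting from \<open>b^2\<close>, the 2-adic valuation of \<open>b ^ k - 1\<close> is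
  that of \<open>b^2 - 1\<close> plus that of \<open>k\<close>, minus 1. If \<open>k\<close> has
  valuation below \<open>v\<close>, then \<open>2 ^ (q + 2 - v)\<close> divides
  \<open>(b - 1) * (b + 1)\<close>, and one of these factors contains a single 2.\<close>

lemma two_power_dvd_exponent:
  assumes "1 \<le> v" "v \<le> q"
  shows "2 ^ v dvd k \<or> 2 ^ (q + 1 - v) dvd b - 1 \<or> 2 ^ (q + 1 - v) dvd b + 1"
proof (cases "v \<le> multiplicity 2 k")
  case True
  thus ?thesis by (metis multiplicity_dvd')
next
  case False
  obtain m where m: "k = 2 * m" using even_k by blast
  have m0: "m > 0" using m k_ge by auto
  have b2: "8 dvd b^2 - 1" using odd_b
  proof -
    obtain c where c: "b = 2 * c + 1" using odd_b by (rule oddE)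
    have "even (c * (c + 1))" by simp
    then obtain d where "c * (c + 1) = 2 * d" by blast
    hence "b^2 - 1 = 8 * d" unfolding c by (simp add: power2_eq_square algebra_simps)
    thus ?thesis by simp
  qed
  have "multiplicity (int 2) ((b^2) ^ m - 1) = multiplicity (int 2) (b^2 - 1) + multiplicity 2 m"
    by (rule multiplicity_power_diff_one)
      (use b2 m0 power_ge_two[of b 2] b_ge odd_b in \<open>auto intro: dvd_trans[of _ "8::int"]\<close>)
  moreover have "multiplicity 2 k = multiplicity 2 m + 1"
    unfolding m using m0 by (subst prime_elem_multiplicity_mult_distrib) auto
  ultimately have "q + 2 - v \<le> multiplicity 2 (b^2 - 1)"
    using two_multiplicities False assms by (simp add: m power_mult)
  hence "2 ^ (q + 2 - v) dvd b^2 - 1" by (rule multiplicity_dvd')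
  also have "q + 2 - v = Suc (q + 1 - v)" using assms by simp
  finally have d: "2 * 2 ^ (q + 1 - v) dvd (b - 1) * (b + 1)"
    by (simp add: power2_eq_square algebra_simps)
  obtain c where c: "b = 2 * c + 1" using odd_b by (rule oddE)
  have "2 * 2 ^ (q + 1 - v) dvd 2 * (2 * (c * (c + 1)))" using d unfolding c by (simp add: algebra_simps)
  hence d2: "2 ^ (q + 1 - v) dvd 2 * (c * (c + 1))" by (simp only: dvd_mult_cancel_left) auto
  show ?thesis
  proof (cases "even c")
    case True
    hence "coprime (2 ^ (q + 1 - v)) (c + 1)" by (simp add: coprime_commute)
    hence "2 ^ (q + 1 - v) dvd 2 * c" using d2 by (metis coprime_dvd_mult_left_iff mult.assoc)
    thus ?thesis unfolding c by simp
  next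
    case False
    hence "coprime (2 ^ (q + 1 - v)) c" by simp
    hence "2 ^ (q + 1 - v) dvd 2 * (c + 1)" using d2
      by (metis coprime_dvd_mult_right_iff mult.left_commute)
    thus ?thesis unfolding c by (simp add: algebra_simps)
  qed
qed

end

section \<open>Products of two differences of powers\<close>

text \<open>The logarithm is \<open>2 artanh s\<close>, and the bound consists of the first two
  terms of its power series.\<close>

lemma ln_quotient_ge:
  fixes s :: real
  assumes "0 \<le> s" "s < 1"
  shows "2 * (s + s ^ 3 / 3) \<le> ln ((1 + s) / (1 - s))"
proof -
  define f where "f = (\<lambda>t::real. ln (1 + t) - ln (1 - t) - 2 * (t + t ^ 3 / 3))"
  have "f 0 \<le> f s"
  proof (rule DERIV_nonneg_imp_nondecreasing[OF assms(1)])
    fix t :: real assume t: "0 \<le> t" "t \<le> s"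
    have n: "1 - t \<noteq> 0" "1 + t \<noteq> 0" using t assms by auto
    have "(f has_real_derivative (1 / (1 + t) + 1 / (1 - t) - 2 * (1 + t ^ 2))) (at t)"
      unfolding f_def by (rule derivative_eq_intros refl | use t assms in force)+
    moreover have "1 / (1 + t) + 1 / (1 - t) - 2 * (1 + t ^ 2) = 2 * t ^ 4 / ((1 + t) * (1 - t))"
      using n by (simp add: divide_simps) (simp add: algebra_simps power_numeral_reduce)
    moreover have "\<dots> \<ge> 0" using t assms by simp
    ultimately show "\<exists>y. (f has_real_derivative y) (at t) \<and> 0 \<le> y" by auto
  qed
  thus ?thesis using assms by (simp add: f_def ln_div)
qed

lemma ln_quotient_ge_linear:
  fixes s :: real
  assumes "0 \<le> s" "s < 1"
  shows "2 * s \<le> ln ((1 + s) / (1 - s))"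
proof -
  have "2 * s \<le> 2 * (s + s ^ 3 / 3)" using assms by simp
  thus ?thesis using ln_quotient_ge[OF assms] by (rule order_trans)
qed

text \<open>From the cubic term on, the series of \<open>artanh\<close> is dominated by a geometric
  series with ratio \<open>s^2\<close>.\<close>

lemma ln_quotient_le:
  fixes s :: real
  assumes "0 \<le> s" "s < 1"
  shows "ln ((1 + s) / (1 - s)) \<le> 2 * (s + s ^ 3 / (3 * (1 - s ^ 2)))"
proof -
  define f where "f = (\<lambda>t::real. 2 * (t + t ^ 3 / (3 * (1 - t ^ 2))) - ln (1 + t) + ln (1 - t))"
  have "f 0 \<le> f s"
  proof (rule DERIV_nonneg_imp_nondecreasing[OF assms(1)])
    fix t :: real assume t: "0 \<le> t" "t \<le> s"
    have n: "1 - t \<noteq> 0" "1 + t \<noteq> 0" using t assms by auto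
    have n2: "1 - t ^ 2 \<noteq> 0" using t assms by (simp add: power2_eq_1_iff)
    have "(f has_real_derivative (2 * (1 + (3 * t ^ 2 * (1 - t ^ 2) + 2 * t ^ 4) / (3 * (1 - t ^ 2) ^ 2))
        - 1 / (1 + t) - 1 / (1 - t))) (at t)"
      unfolding f_def using n n2 t assms
      by (auto intro!: derivative_eq_intros) (simp add: divide_simps, simp add: algebra_simps power_numeral_reduce)?
    moreover have "2 * (1 + (3 * t ^ 2 * (1 - t ^ 2) + 2 * t ^ 4) / (3 * (1 - t ^ 2) ^ 2)) - 1 / (1 + t) - 1 / (1 - t)
        = 4 * t ^ 4 / (3 * (1 - t ^ 2) ^ 2)"
    proof -
      have "1 / (1 + t) + 1 / (1 - t) = 2 / (1 - t ^ 2)"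
        using n n2 by (simp add: divide_simps) (simp add: algebra_simps power2_eq_square)
      moreover have "2 * (1 + (3 * t ^ 2 * (1 - t ^ 2) + 2 * t ^ 4) / (3 * (1 - t ^ 2) ^ 2)) - 2 / (1 - t ^ 2)
          = 4 * t ^ 4 / (3 * (1 - t ^ 2) ^ 2)"
        using n2 by (simp add: divide_simps) (simp add: algebra_simps power_numeral_reduce)
      ultimately show ?thesis by linarith
    qed
    moreover have "4 * t ^ 4 / (3 * (1 - t ^ 2) ^ 2) \<ge> 0" by simp
    ultimately show "\<exists>y. (f has_real_derivative y) (at t) \<and> 0 \<le> y" by metis
  qed
  thus ?thesis using assms by (simp add: f_def ln_div)
qed

text \<open>With \<open>u = X\<^sup>q\<close> and \<open>A = q u - (q + 1) / 2\<close>, the fraction \<open>A / (A + 1)\<close> is the Pade approximant of type (1, 1)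
  to the \<open>q\<close>-th root of \<open>1 - 1 / u\<close>. The integer \<open>X Y A - Z (A + 1)\<close> turns out to lie strictly between 0 and 1.\<close>

lemma no_power_product_solution:
  fixes X Y Z :: int and q :: nat
  assumes q: "odd q" "q \<ge> 3" and X: "X \<ge> 2" and Y: "Y \<ge> 2" and Z: "Z \<ge> 1"
    and eq: "(X ^ q - 1) * (Y ^ q - 1) = Z ^ q"
    and YX: "Y \<le> X ^ q" and big: "2 * X ^ (q + 1) < Y ^ (q - 1)"
  shows False
proof -
  define A where "A = int q * X ^ q - (int q + 1) div 2"
  define u v x y z r :: real where "u = X ^ q" and "v = Y ^ q" and "x = X" and "y = Y" and "z = Z" and "r = q"
  define a :: real where "a = A"
  \<comment> \<open>This \<open>s\<close> turns \<open>(1 + s) / (1 - s)\<close> into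
    \<open>u / (u - 1)\<close>, and \<open>s / r\<close> likewise gives \<open>(a + 1) / a\<close>.
    Both logarithms become values of \<open>2 artanh\<close>, and in \<open>D\<close> below the
    terms linear in \<open>s\<close> cancel.\<close>
  define s where "s = 1 / (2 * u - 1)"
  have r: "r \<ge> 3" using q by (simp add: r_def)
  have xyz: "x \<ge> 2" "y \<ge> 2" "z \<ge> 1" using X Y Z by (simp_all add: x_def y_def z_def)
  have ux: "u \<ge> 4 * x"
  proof -
    have "x ^ 3 \<le> x ^ q" using xyz q by (intro power_increasing) auto
    moreover have "x ^ 3 = x * x * x" by (simp add: power3_eq_cube)
    moreover have "x * x * x \<ge> 2 * 2 * x" using xyz by (intro mult_mono) auto
    ultimately show ?thesis by (simp add: u_def x_def)
  qed
  have u8: "u \<ge> 8" using ux xyz by linarith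
  have uv: "u = x ^ q" "v = y ^ q" by (simp_all add: u_def v_def x_def y_def)
  have vy: "v = y * y ^ (q - 1)" using q by (simp add: uv power_eq_if)
  have v1: "v > 1" using xyz q by (simp add: uv)
  have a: "a = r * u - (r + 1) / 2"
    using q(1) unfolding a_def A_def r_def u_def by (auto elim!: oddE simp: field_simps)
  have ru: "r * u \<ge> 8 * r" using u8 r by simp
  have a0: "a > 0"
  proof -
    have "2 * a = 2 * (r * u) - r - 1" unfolding a by (simp add: field_simps)
    thus ?thesis using ru r by linarith
  qed
  have au: "a < r * u" using a r by simp
  have s0: "0 < s" "s < 1" using u8 by (simp_all add: s_def)
  have sr: "s / r < 1" "0 < s / r" using s0 r by (simp_all add: divide_simps)
  have lu: "ln ((1 + s) / (1 - s)) = ln (u / (u - 1))"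
  proof -
    have "(1 + s) / (1 - s) = u / (u - 1)" using u8 by (simp add: s_def divide_simps)
    thus ?thesis by simp
  qed
  have la: "ln ((1 + s / r) / (1 - s / r)) = ln ((a + 1) / a)"
  proof -
    have "(1 + s / r) / (1 - s / r) = (r * (2 * u - 1) + 1) / (r * (2 * u - 1) - 1)"
    proof -
      have n: "r * (2 * u - 1) > 1" using u8 r mult_mono[of 3 r 15 "2 * u - 1"] by simp
      have "s / r = 1 / (r * (2 * u - 1))" by (simp add: s_def)
      moreover have "(1 + 1 / w) / (1 - 1 / w) = (w + 1) / (w - 1)" if "w > 1" for w :: real
        using that by (simp add: divide_simps)
      ultimately show ?thesis using n by metis
    qed
    also have "r * (2 * u - 1) + 1 = 2 * (a + 1)" unfolding a by (simp add: field_simps)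
    also have "r * (2 * u - 1) - 1 = 2 * a" unfolding a by (simp add: field_simps)
    also have "2 * (a + 1) / (2 * a) = (a + 1) / a" by (rule mult_divide_mult_cancel_left) simp
    finally show ?thesis by simp
  qed
  have zeq: "r * ln z = ln (u - 1) + ln (v - 1)"
  proof -
    have "(u - 1) * (v - 1) = z ^ q" unfolding u_def v_def z_def using eq
      by (metis of_int_1 of_int_diff of_int_mult of_int_power)
    hence "ln (z ^ q) = ln ((u - 1) * (v - 1))" by simp
    also have "\<dots> = ln (u - 1) + ln (v - 1)" using u8 v1 by (intro ln_mult_pos) auto
    finally have "ln (z ^ q) = ln (u - 1) + ln (v - 1)" .
    thus ?thesis using xyz by (simp add: ln_realpow r_def)
  qed
  have lnu: "ln u = r * ln x" "ln v = r * ln y" using xyz by (simp_all add: uv ln_realpow r_def)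
  \<comment> \<open>\<open>D\<close> is the error of the Pade approximant on the logarithmic scale,
    and \<open>e\<close> comes from the 1 subtracted from \<open>Y ^ q\<close>.\<close>
  define D where "D = ln (u / (u - 1)) - r * ln ((a + 1) / a)"
  define e where "e = ln (v / (v - 1))"
  have e: "0 < e" "e \<le> 1 / (v - 1)"
  proof -
    have "v / (v - 1) = 1 + 1 / (v - 1)" using v1 by (simp add: divide_simps)
    moreover have "1 / (v - 1) > 0" using v1 by simp
    ultimately show "0 < e" "e \<le> 1 / (v - 1)" using ln_gt_zero[of "1 + 1 / (v - 1)"] ln_add_one_self_le_self[of "1 / (v - 1)"]
      by (simp_all add: e_def)
  qed
  have key: "r * (ln (x * y * a) - ln (z * (a + 1))) = D + e"
  proof -
    have "ln (x * y * a) = ln x + ln y + ln a" "ln (z * (a + 1)) = ln z + ln (a + 1)"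
      "ln (u / (u - 1)) = ln u - ln (u - 1)" "ln (v / (v - 1)) = ln v - ln (v - 1)"
      "ln ((a + 1) / a) = ln (a + 1) - ln a"
      using xyz a0 u8 v1 by (simp_all add: ln_mult_pos ln_div)
    thus ?thesis unfolding D_def e_def using zeq lnu by (simp add: right_diff_distrib distrib_left)
  qed
  have D0: "0 \<le> D"
  proof -
    have "r * ln ((a + 1) / a) \<le> r * (2 * (s / r + (s / r) ^ 3 / (3 * (1 - (s / r) ^ 2))))"
      using ln_quotient_le[of "s / r"] sr r la by (intro mult_left_mono) auto
    also have "\<dots> = 2 * (s + s ^ 3 / (3 * (r ^ 2 - s ^ 2)))"
      using r s0 by (simp add: divide_simps power_numeral_reduce)
    also have "\<dots> \<le> 2 * (s + s ^ 3 / 3)"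
    proof -
      have "s ^ 2 \<le> 1" using s0 by (simp add: power_le_one)
      moreover have "r ^ 2 \<ge> 3 ^ 2" using r by (intro power_mono) auto
      ultimately have "3 * (r ^ 2 - s ^ 2) \<ge> 3" by simp
      hence "s ^ 3 / (3 * (r ^ 2 - s ^ 2)) \<le> s ^ 3 / 3" using s0 by (intro divide_left_mono) auto
      thus ?thesis by simp
    qed
    also have "\<dots> \<le> ln (u / (u - 1))" using ln_quotient_ge[of s] s0 lu by simp
    finally show ?thesis by (simp add: D_def)
  qed
  have D1: "D \<le> 2 * (s ^ 3 / (3 * (1 - s ^ 2)))"
  proof -
    have "r * (2 * (s / r)) \<le> r * ln ((a + 1) / a)"
      using ln_quotient_ge_linear[of "s / r"] sr r la by (intro mult_left_mono) auto
    hence "2 * s \<le> r * ln ((a + 1) / a)" using r by simp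
    thus ?thesis using ln_quotient_le[of s] s0 lu unfolding D_def by (simp add: algebra_simps)
  qed
  have pos: "x * y * a > 0" "z * (a + 1) > 0" using xyz a0 by simp_all
  have "0 < r * (ln (x * y * a) - ln (z * (a + 1)))" using key D0 e by linarith
  hence "ln (z * (a + 1)) < ln (x * y * a)" using r by (simp add: zero_less_mult_iff)
  hence lt: "z * (a + 1) < x * y * a" using pos by simp
  hence "Z * (A + 1) < X * Y * A" unfolding z_def x_def y_def a_def
    by (metis of_int_1 of_int_add of_int_less_iff of_int_mult)
  hence "Z * (A + 1) + 1 \<le> X * Y * A" by simp
  hence le: "z * (a + 1) + 1 \<le> x * y * a" unfolding z_def x_def y_def a_def
    by (metis of_int_1 of_int_add of_int_le_iff of_int_mult)
  \<comment> \<open>The two integers differ by at least 1, which bounds the difference of their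
    logarithms from below.\<close>
  have "ln (z * (a + 1)) - ln (x * y * a) = ln (z * (a + 1) / (x * y * a))"
    by (rule ln_divide_pos[symmetric]) (fact pos)+
  also have "\<dots> \<le> z * (a + 1) / (x * y * a) - 1" using pos by (intro ln_le_minus_one) simp
  also have "\<dots> \<le> - 1 / (x * y * a)" using pos le by (simp add: divide_simps)
  finally have "1 / (x * y * a) \<le> ln (x * y * a) - ln (z * (a + 1))" by simp
  hence "r * (1 / (x * y * a)) \<le> D + e" unfolding key[symmetric] using r by (intro mult_left_mono) auto
  also have "\<dots> \<le> 2 * (s ^ 3 / (3 * (1 - s ^ 2))) + 1 / (v - 1)" using D1 e by linarith
  finally have f1: "r * (1 / (x * y * a)) \<le> 2 * (s ^ 3 / (3 * (1 - s ^ 2))) + 1 / (v - 1)" .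
  \<comment> \<open>Each of the two error terms is at most half of \<open>1 / (x * y * u)\<close>:
    the first because \<open>Y \<le> X ^ q\<close>, the second by \<open>big\<close>.\<close>
  have "1 / (x * y * u) < r * (1 / (x * y * a))"
    using au a0 xyz u8 by (simp add: divide_simps mult_ac)
  also note f1
  also have "2 * (s ^ 3 / (3 * (1 - s ^ 2))) = 1 / (6 * u * (u - 1) * (2 * u - 1))"
  proof -
    define w where "w = 2 * u - 1"
    have w: "w \<ge> 15" "u = (w + 1) / 2" using u8 by (simp_all add: w_def)
    have w2: "w ^ 2 - 1 = (w - 1) * (w + 1)" by (simp add: power2_eq_square algebra_simps)
    have "s ^ 3 / (3 * (1 - s ^ 2)) = 1 / (3 * (w * (w ^ 2 - 1)))"
      unfolding s_def w_def[symmetric] using w by (simp add: divide_simps power_numeral_reduce)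
    also have "w * (w ^ 2 - 1) = (2 * u - 1) * (4 * (u * (u - 1)))"
      unfolding w_def by (simp add: power2_eq_square algebra_simps)
    finally have "2 * (s ^ 3 / (3 * (1 - s ^ 2))) = 2 / (2 * (6 * u * (u - 1) * (2 * u - 1)))"
      by (simp add: algebra_simps)
    thus ?thesis by simp
  qed
  also have "1 / (6 * u * (u - 1) * (2 * u - 1)) \<le> 1 / (2 * (x * y * u))"
  proof -
    have yu: "y \<le> u" unfolding y_def u_def using YX by (metis of_int_le_iff of_int_power)
    have "x * y \<le> (u - 1) * u" using yu ux xyz u8 by (intro mult_mono) auto
    also have "\<dots> \<le> (u - 1) * (3 * (2 * u - 1))" using u8 by (intro mult_left_mono) auto
    finally have "(x * y) * (2 * u) \<le> (u - 1) * (3 * (2 * u - 1)) * (2 * u)"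
      using u8 by (intro mult_right_mono) auto
    hence "2 * (x * y * u) \<le> 6 * u * (u - 1) * (2 * u - 1)" by (simp add: algebra_simps)
    thus ?thesis using xyz u8 by (intro divide_left_mono) auto
  qed
  also have "1 / (v - 1) \<le> 1 / (2 * (x * y * u))"
  proof -
    have "2 * X ^ (q + 1) + 1 \<le> Y ^ (q - 1)" using big by simp
    hence "real_of_int (2 * X ^ (q + 1) + 1) \<le> real_of_int (Y ^ (q - 1))" by (simp only: of_int_le_iff)
    hence "2 * (x * u) + 1 \<le> y ^ (q - 1)" by (simp add: x_def y_def u_def)
    hence "y * (2 * (x * u) + 1) \<le> v" unfolding vy using xyz by (intro mult_left_mono) auto
    hence "2 * (x * y * u) \<le> v - 1" using xyz by (simp add: algebra_simps)
    thus ?thesis using xyz u8 by (intro divide_left_mono) (auto simp: v1)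
  qed
  finally show False using xyz u8 by (simp add: field_simps)
qed

section \<open>Roots of unity modulo prime powers\<close>

text \<open>Uniqueness in Hensel's lemma: the cofactor of \<open>x - z\<close> is
  \<open>(p - 1) * z ^ (p - 2)\<close> modulo \<open>p\<close>, so it is prime to
  \<open>p\<close>.\<close>

lemma dvd_pred_power_unique:
  fixes x z :: int
  assumes "prime p" "\<not> int p dvd z" "int p dvd x - z" "0 < e"
    and "int p ^ e dvd x ^ (p - 1) - 1" "int p ^ e dvd z ^ (p - 1) - 1"
  shows "int p ^ e dvd x - z"
proof -
  have p: "prime (int p)" using assms by simp
  have p1: "p > 1" using assms(1) prime_gt_1_nat by blast
  have "int p ^ e dvd (x ^ (p - 1) - 1) - (z ^ (p - 1) - 1)" using assms(5,6) by (rule dvd_diff)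
  hence d: "int p ^ e dvd (x - z) * (\<Sum>i<p - 1. z ^ (p - 1 - Suc i) * x ^ i)"
    by (simp add: power_diff_sumr2)
  have "[(\<Sum>i<p - 1. z ^ (p - 1 - Suc i) * x ^ i) = (\<Sum>i<p - 1. z ^ (p - 1 - Suc i) * z ^ i)] (mod int p)"
    by (intro cong_sum cong_mult cong_pow cong_refl) (use assms(3) in \<open>simp add: cong_iff_dvd_diff\<close>)
  also have "(\<Sum>i<p - 1. z ^ (p - 1 - Suc i) * z ^ i) = (\<Sum>i<p - 1. z ^ (p - 2))"
    by (intro sum.cong) (auto simp flip: power_add)
  finally have c: "[(\<Sum>i<p - 1. z ^ (p - 1 - Suc i) * x ^ i) = int (p - 1) * z ^ (p - 2)] (mod int p)"
    by simp
  have "\<not> int p dvd int (p - 1) * z ^ (p - 2)"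
  proof
    assume "int p dvd int (p - 1) * z ^ (p - 2)"
    then consider "int p dvd int (p - 1)" | "int p dvd z ^ (p - 2)" using p prime_dvd_mult_iff by blast
    thus False
    proof cases
      case 1
      hence "p dvd p - 1" using int_dvd_int_iff by blast
      thus ?thesis using p1 by (auto dest: dvd_imp_le)
    next
      case 2
      thus ?thesis using p assms(2) prime_dvd_power by blast
    qed
  qed
  hence "\<not> int p dvd (\<Sum>i<p - 1. z ^ (p - 1 - Suc i) * x ^ i)" using c cong_dvd_iff by blast
  hence "coprime (int p ^ e) (\<Sum>i<p - 1. z ^ (p - 1 - Suc i) * x ^ i)"
    using p by (simp add: prime_imp_coprime)
  thus ?thesis using d by (simp add: coprime_dvd_mult_left_iff)
qed

text \<open>The solutions of \<open>x ^ (p - 1) = 1\<close> modulo \<open>p ^ e\<close> are the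
  powers \<open>w ^ i\<close> with \<open>i < (p - 1) div 2\<close> and their negatives. That
  \<open>w\<close> generates them follows from \<open>wn\<close> and \<open>avoid\<close>.\<close>

lemma teichmueller_lifts_avoid_interval:
  fixes w :: int and B :: int
  assumes "prime p" "odd p" "0 < e" "2 \<le> x" "x \<le> B" and B: "B + 1 < int p ^ e"
    and wn: "[w ^ ((p - 1) div 2) = -1] (mod int p ^ e)"
    and avoid: "\<And>i c. 0 < i \<Longrightarrow> i < (p - 1) div 2 \<Longrightarrow> \<bar>c\<bar> \<le> B \<Longrightarrow> \<not> [w ^ i = c] (mod int p ^ e)"
  shows "\<not> int p ^ e dvd x ^ (p - 1) - 1"
proof
  assume x: "int p ^ e dvd x ^ (p - 1) - 1"
  define n where "n = (p - 1) div 2"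
  have p2: "p > 2" using assms(1,2) prime_gt_1_nat[of p] by (cases "p = 2") auto
  have n: "p - 1 = 2 * n" "n > 0" unfolding n_def using assms(2) p2 by auto
  have pe: "int p dvd int p ^ e" using assms(3) by (simp add: dvd_power)
  have wn': "[w ^ n = -1] (mod int p)" using wn pe cong_dvd_modulus unfolding n_def by blast
  have nw: "\<not> int p dvd w"
  proof
    assume "int p dvd w"
    hence "int p dvd w ^ n" using n by (meson dvd_power dvd_trans)
    hence "int p dvd -1" using wn' cong_dvd_iff by blast
    thus False using p2 by simp
  qed
  have w1: "int p ^ e dvd w ^ (p - 1) - 1"
  proof -
    have "[(w ^ n) ^ 2 = (-1) ^ 2] (mod int p ^ e)" using wn n_def by (intro cong_pow) simp
    hence "[w ^ (2 * n) = 1] (mod int p ^ e)" by (simp add: power_mult[symmetric] mult.commute)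
    thus ?thesis unfolding n(1) by (simp add: cong_iff_dvd_diff)
  qed
  have wi1: "int p ^ e dvd (s * w ^ i) ^ (p - 1) - 1" if "s = 1 \<or> s = -1" for s i
  proof -
    have "[(w ^ (p - 1)) ^ i = 1 ^ i] (mod int p ^ e)" using w1 by (intro cong_pow) (simp add: cong_iff_dvd_diff)
    hence "[(w ^ i) ^ (p - 1) = 1] (mod int p ^ e)" by (metis power_commutes power_mult mult.commute power_one)
    moreover have "s ^ (p - 1) = 1" unfolding n(1) using that by auto
    ultimately show ?thesis unfolding power_mult_distrib by (simp add: cong_iff_dvd_diff)
  qed
  define g where "g = nat (w mod int p)"
  have g: "int g = w mod int p" using p2 by (simp add: g_def)
  have gc: "[int g ^ i = w ^ i] (mod int p)" for i unfolding g by (simp add: cong_def power_mod)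
  \<comment> \<open>A power that is 1 modulo \<open>p\<close> is 1 modulo \<open>p ^ e\<close> by
    uniqueness of lifts, and 1 is among the avoided values.\<close>
  have not1: "\<not> [w ^ i = 1] (mod int p)" if "0 < i" "i < n" for i
  proof
    assume "[w ^ i = 1] (mod int p)"
    hence a: "int p dvd w ^ i - 1" by (simp add: cong_iff_dvd_diff)
    have b: "\<not> int p dvd 1" using p2 by simp
    have c: "int p ^ e dvd (w ^ i) ^ (p - 1) - 1" using wi1[of 1 i] by simp
    have d: "int p ^ e dvd 1 ^ (p - 1) - (1::int)" by simp
    have "int p ^ e dvd w ^ i - 1"
      by (rule dvd_pred_power_unique[OF assms(1) b a assms(3) c d])
    hence "[w ^ i = 1] (mod int p ^ e)" by (simp add: cong_iff_dvd_diff)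
    moreover have "\<bar>1::int\<bar> \<le> B" using assms(4,5) by simp
    ultimately show False using avoid[of i 1] that unfolding n_def by blast
  qed
  have cop: "coprime p g" using nw g assms(1) by (metis dvd_mod_iff dvd_refl int_dvd_int_iff prime_imp_coprime)
  have ordg: "ord p g = p - 1"
  proof -
    have o0: "ord p g > 0" using cop by (simp add: ord_eq_0)
    have "[int g ^ (2 * n) = 1] (mod int p)"
      using fermat_dvd[OF assms(1) nw] gc[of "2 * n"] n by (metis cong_iff_dvd_diff cong_trans)
    hence "[g ^ (2 * n) = 1] (mod p)" by (metis cong_int_iff of_nat_1 of_nat_power)
    hence od: "ord p g dvd 2 * n" by (simp only: ord_divides)
    have "[g ^ ord p g = 1] (mod p)" by (rule ord)
    hence "[int g ^ ord p g = 1] (mod int p)" by (metis cong_int_iff of_nat_1 of_nat_power)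
    hence o1: "[w ^ ord p g = 1] (mod int p)" using gc cong_sym cong_trans by blast
    have "\<not> ord p g < n" using not1[of "ord p g"] o0 o1 by blast
    moreover have "ord p g \<noteq> n"
    proof
      assume "ord p g = n"
      hence "[-1 = 1] (mod int p)" using o1 wn' cong_sym cong_trans by metis
      hence "int p dvd 2" by (simp add: cong_iff_dvd_diff)
      thus False using p2 zdvd_imp_le by fastforce
    qed
    ultimately have "n < ord p g" by simp
    obtain d where d: "2 * n = ord p g * d" using od by auto
    have "d < 2"
    proof (rule ccontr)
      assume "\<not> d < 2"
      hence "ord p g * 2 \<le> ord p g * d" by (intro mult_le_mono) auto
      thus False using d \<open>n < ord p g\<close> by linarith
    qed
    moreover have "d \<noteq> 0" using d n(2) by (intro notI) simp
    ultimately have "d = 1" by linarith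
    with d have "2 * n = ord p g" by simp
    thus ?thesis using n(1) by linarith
  qed
  have root: "residue_primroot p g"
    unfolding residue_primroot_def using p2 cop ordg assms(1) by (simp add: totient_prime)
  have nx: "\<not> int p dvd x"
  proof
    assume "int p dvd x"
    hence "int p dvd x ^ (p - 1)" using p2 by (intro dvd_trans[OF _ dvd_power]) auto
    moreover have "int p dvd x ^ (p - 1) - 1" using x pe dvd_trans by blast
    ultimately have "int p dvd 1" by (metis dvd_diff_right_iff dvd_diff_commute)
    thus False using p2 by simp
  qed
  define x' where "x' = nat (x mod int p)"
  have x': "int x' = x mod int p" using p2 by (simp add: x'_def)
  have "x' < p" using x' p2 by (metis of_nat_less_iff pos_mod_bound of_nat_0_less_iff less_trans zero_less_numeral)
  moreover have "x' \<noteq> 0" using nx x' by (metis dvd_eq_mod_eq_0 of_nat_0)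
  ultimately have "x' \<in> totatives p"
    using assms(1) by (simp add: totatives_prime)
  moreover have "bij_betw (\<lambda>i. g ^ i mod p) {..<totient p} (totatives p)"
    using p2 root by (intro residue_primroot_is_generator) auto
  ultimately obtain i where i: "i < p - 1" "x' = g ^ i mod p"
    using assms(1) by (auto simp: bij_betw_def totient_prime)
  have xi: "[x = w ^ i] (mod int p)"
  proof -
    have "[int x' = int (g ^ i)] (mod int p)" unfolding i(2) by (simp add: cong_def zmod_int)
    moreover have "[int x' = x] (mod int p)" unfolding x' by (simp add: cong_def)
    ultimately show ?thesis using gc[of i] by (metis cong_sym cong_trans of_nat_power)
  qed
  \<comment> \<open>Exponents from \<open>n\<close> on are folded back by \<open>w ^ n = -1\<close>,
    at the cost of a sign.\<close>
  obtain s i' where si: "s = 1 \<or> s = -1" "i' < n" "[x = s * w ^ i'] (mod int p)"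
  proof (cases "i < n")
    case True
    thus thesis using that[of 1 i] xi by simp
  next
    case False
    have "w ^ i = w ^ n * w ^ (i - n)" using False by (simp flip: power_add)
    moreover have "[w ^ n * w ^ (i - n) = -1 * w ^ (i - n)] (mod int p)"
      using wn' by (rule cong_scalar_right)
    ultimately have "[x = -1 * w ^ (i - n)] (mod int p)" using xi cong_trans by metis
    thus thesis using that[of "-1" "i - n"] i n False by auto
  qed
  have "int p ^ e dvd x - s * w ^ i'"
  proof (rule dvd_pred_power_unique[OF assms(1) _ _ assms(3) x])
    show "int p dvd x - s * w ^ i'" using si(3) by (simp add: cong_iff_dvd_diff)
    show "\<not> int p dvd s * w ^ i'" using nx si(3) cong_dvd_iff by blast
    show "int p ^ e dvd (s * w ^ i') ^ (p - 1) - 1" by (rule wi1[OF si(1)])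
  qed
  hence c: "[x = s * w ^ i'] (mod int p ^ e)" by (simp add: cong_iff_dvd_diff)
  show False
  \<comment> \<open>The roots 1 and -1 are excluded by size, all others by
    \<open>avoid\<close>.\<close>
  proof (cases "i' = 0")
    case True
    hence "int p ^ e dvd x - s" using c by (simp add: cong_iff_dvd_diff)
    moreover have "x - s > 0" "x - s \<le> B + 1" using si(1) assms(4,5) by auto
    ultimately show False using zdvd_imp_le[of "int p ^ e" "x - s"] B by simp
  next
    case False
    have "s * s = 1" using si(1) by auto
    hence "[w ^ i' = s * x] (mod int p ^ e)" using cong_scalar_left[OF c, of s]
      by (simp add: cong_sym_eq flip: mult.assoc)
    moreover have "\<bar>s * x\<bar> \<le> B" using si(1) assms(4,5) by auto
    ultimately show False using avoid[of i'] si(2) False unfolding n_def by blast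
  qed
qed

section \<open>Powers modulo M by table look-up and binary search\<close>

text \<open>Residues modulo \<open>M\<close> are multiplied by a fixed \<open>w\<close> without any division: the product is a sum of
  entries of a table of \<open>2\<^sup>i w mod M\<close>, and it is left unreduced. As at most 46 entries are added, the
  state stays below \<open>64 M\<close>, and a search tree locates it between two multiples of \<open>M\<close>.\<close>

datatype doubles = Last int | More int doubles

fun subset_sum :: "num \<Rightarrow> doubles \<Rightarrow> int" where
  "subset_sum n (Last a) = numeral n * a"
| "subset_sum num.One (More a as) = a"
| "subset_sum (num.Bit0 n) (More a as) = subset_sum n as"
| "subset_sum (num.Bit1 n) (More a as) = a + subset_sum n as"

primrec doubles_mod :: "nat \<Rightarrow> int \<Rightarrow> int \<Rightarrow> doubles" where
  "doubles_mod 0 M a = Last a"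
| "doubles_mod (Suc n) M a = More a (doubles_mod n M (if a + a < M then a + a else a + a - M))"

text \<open>Either branch of the conditional is congruent to \<open>2 * a\<close>, and
  \<open>Last\<close> multiplies by what is left of the number, so the congruence holds for every
  table length.\<close>

lemma subset_sum_doubles_mod: "[subset_sum n (doubles_mod l M a) = numeral n * a] (mod M)"
proof (induction l arbitrary: n a)
  case (Suc l)
  define a' where "a' = (if a + a < M then a + a else a + a - M)"
  have a': "[a' = 2 * a] (mod M)" by (simp add: a'_def cong_iff_dvd_diff)
  have IH: "[subset_sum m (doubles_mod l M a') = numeral m * (2 * a)] (mod M)" for m
    by (rule cong_trans[OF Suc cong_scalar_left[OF a']])
  have double: "(x + x) * a = x * (2 * a)"
    and double_succ: "(x + x + 1) * a = a + x * (2 * a)" for x :: int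
    by (simp_all add: algebra_simps)
  show ?case
  proof (cases n)
    case (Bit1 m)
    have "subset_sum n (doubles_mod (Suc l) M a) = a + subset_sum m (doubles_mod l M a')"
      unfolding Bit1 a'_def by simp
    moreover have "numeral n * a = a + numeral m * (2 * a)"
      unfolding Bit1 numeral_Bit1[of m] by (rule double_succ)
    ultimately show ?thesis using cong_add[OF cong_refl IH[of m], of a] by (simp only:)
  next
    case (Bit0 m)
    have "subset_sum n (doubles_mod (Suc l) M a) = subset_sum m (doubles_mod l M a')"
      unfolding Bit0 a'_def by simp
    moreover have "numeral n * a = numeral m * (2 * a)"
      unfolding Bit0 numeral_Bit0[of m] by (rule double)
    ultimately show ?thesis using IH[of m] by (simp only:)
  qed simp
qed simp

datatype windows = Window int int | Split int windows windows

primrec in_windows :: "windows \<Rightarrow> int \<Rightarrow> bool" where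
  "in_windows (Window l u) t \<longleftrightarrow> l < t \<and> t < u"
| "in_windows (Split m a b) t \<longleftrightarrow> (if t < m then in_windows a t else in_windows b t)"

text \<open>With offsets \<open>32 * M\<close> down to \<open>M\<close>, the path to a leaf spells
  the binary digits of the quotient of \<open>t\<close> by \<open>M\<close>. The leaf demands a
  distance of more than \<open>10 ^ 6\<close> from both neighbouring multiples.\<close>

primrec window_tree :: "int \<Rightarrow> int list \<Rightarrow> int \<Rightarrow> windows" where
  "window_tree M [] c = Window (c + 10 ^ 6) (c + M - 10 ^ 6)"
| "window_tree M (d # ds) c = Split (c + d) (window_tree M ds c) (window_tree M ds (c + d))"

lemma in_windowsD:
  assumes "in_windows (window_tree M ds c) t" "\<forall>d\<in>set ds. M dvd d \<and> 0 \<le> d" "M dvd c" "0 \<le> c"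
  shows "\<exists>c'\<ge>0. M dvd c' \<and> c' + 10 ^ 6 < t \<and> t < c' + M - 10 ^ 6"
  using assms
proof (induction ds arbitrary: c)
  case (Cons d ds)
  show ?case
  proof (cases "t < c + d")
    case True
    thus ?thesis using Cons.prems by (intro Cons.IH[of c]) auto
  next
    case False
    thus ?thesis using Cons.prems by (intro Cons.IH[of "c + d"]) auto
  qed
qed auto

text \<open>Started at \<open>t = w\<close>, this tests \<open>w\<close> up to \<open>w ^ n\<close>
  and then whether \<open>w ^ (n + 1)\<close> is -1; for \<open>p = 2 * n + 3\<close> that exponent
  is \<open>(p - 1) div 2\<close>.\<close>

primrec powers_avoid :: "nat \<Rightarrow> doubles \<Rightarrow> windows \<Rightarrow> int \<Rightarrow> int \<Rightarrow> bool" where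
  "powers_avoid 0 D W M t \<longleftrightarrow> M dvd t + 1"
| "powers_avoid (Suc n) D W M t \<longleftrightarrow>
     in_windows W t \<and> powers_avoid n D W M (subset_sum (num_of_nat (nat t)) D)"

lemma not_cong_small:
  fixes M :: int
  assumes "M dvd c'" "c' + B < t" "t < c' + M - B" "\<bar>c\<bar> \<le> B"
  shows "\<not> [t = c] (mod M)"
proof
  assume "[t = c] (mod M)"
  hence "M dvd t - c - c'" using assms(1) by (simp add: cong_iff_dvd_diff)
  moreover have "0 < t - c - c'" "t - c - c' < M" using assms by auto
  ultimately show False using zdvd_imp_le by fastforce
qed

lemma powers_avoidD:
  assumes "powers_avoid n (doubles_mod l M w) (window_tree M ds 0) M t" "[t = w ^ j] (mod M)"
    and "\<forall>d\<in>set ds. M dvd d \<and> 0 \<le> d"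
  shows "[w ^ (j + n) = -1] (mod M) \<and> (\<forall>i<n. \<forall>c. \<bar>c\<bar> \<le> 10 ^ 6 \<longrightarrow> \<not> [w ^ (j + i) = c] (mod M))"
  using assms(1,2)
proof (induction n arbitrary: t j)
  case 0
  hence "[t = -1] (mod M)" by (simp add: cong_iff_dvd_diff)
  thus ?case using 0 cong_sym cong_trans by (metis add_0_right not_less0)
next
  case (Suc n)
  obtain c' where c': "c' \<ge> 0" "M dvd c'" "c' + 10 ^ 6 < t" "t < c' + M - 10 ^ 6"
    using in_windowsD[of M ds 0 t] Suc.prems assms(3) by auto
  \<comment> \<open>The window forces \<open>t > 0\<close>, so the passage through
    \<open>nat\<close> and \<open>num\<close> is faithful.\<close>
  have "numeral (num_of_nat (nat t)) = t"
  proof -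
    have "0 < nat t" using c' by simp
    hence "int (numeral (num_of_nat (nat t))) = int (nat t)" by (simp only: numeral_num_of_nat)
    thus ?thesis using c' by simp
  qed
  hence "[subset_sum (num_of_nat (nat t)) (doubles_mod l M w) = t * w] (mod M)"
    using subset_sum_doubles_mod[of "num_of_nat (nat t)" l M w] by simp
  also have "[t * w = w ^ Suc j] (mod M)" using cong_scalar_right[OF Suc.prems(2), of w] by (simp add: mult.commute)
  finally have "[w ^ (Suc j + n) = -1] (mod M) \<and> (\<forall>i<n. \<forall>c. \<bar>c\<bar> \<le> 10 ^ 6 \<longrightarrow> \<not> [w ^ (Suc j + i) = c] (mod M))"
    using Suc.prems by (intro Suc.IH) auto
  moreover have "\<not> [w ^ j = c] (mod M)" if "\<bar>c\<bar> \<le> 10 ^ 6" for c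
    using not_cong_small[OF c'(2-4) that] Suc.prems(2) cong_trans by blast
  ultimately show ?case
    by (auto simp: less_Suc_eq_0_disj)
qed

text \<open>With \<open>M\<close> as an argument, the prime power can be evaluated to a numeral
  before it is copied into table and tree. The 45 doublings cover numbers below
  \<open>2 ^ 46\<close>, which exceeds \<open>64 * M\<close> for every modulus used.\<close>

definition lifts_avoid :: "nat \<Rightarrow> int \<Rightarrow> int \<Rightarrow> bool" where
  "lifts_avoid n M w \<longleftrightarrow> 10 ^ 6 + 1 < M \<and> powers_avoid n (doubles_mod 45 M w)
     (window_tree M [32 * M, 16 * M, 8 * M, 4 * M, 2 * M, M] 0) M w"

definition teichmueller_check :: "nat \<Rightarrow> nat \<Rightarrow> int \<Rightarrow> bool" where
  "teichmueller_check n e w \<longleftrightarrow> 0 < e \<and> lifts_avoid n (int (2 * n + 3) ^ e) w"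

lemma teichmueller_check_imp_not_dvd:
  assumes "prime (2 * n + 3)" "teichmueller_check n e w" "2 \<le> x" "x \<le> 10 ^ 6"
  shows "\<not> int (2 * n + 3) ^ e dvd x ^ (2 * n + 2) - 1"
proof -
  define M where "M = int (2 * n + 3) ^ e"
  have n: "(2 * n + 3 - 1) div 2 = 1 + n" by simp
  have chk: "0 < e" "10 ^ 6 + 1 < M"
    and avoid: "powers_avoid n (doubles_mod 45 M w)
      (window_tree M [32 * M, 16 * M, 8 * M, 4 * M, 2 * M, M] 0) M w"
    using assms(2) unfolding teichmueller_check_def lifts_avoid_def M_def by blast+
  from avoid have "[w ^ (1 + n) = -1] (mod M) \<and>
      (\<forall>i<n. \<forall>c. \<bar>c\<bar> \<le> 10 ^ 6 \<longrightarrow> \<not> [w ^ (1 + i) = c] (mod M))"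
    by (rule powers_avoidD) (auto simp: M_def)
  note av = this[THEN conjunct1] this[THEN conjunct2, rule_format]
  have "\<not> int (2 * n + 3) ^ e dvd x ^ (2 * n + 3 - 1) - 1"
  proof (rule teichmueller_lifts_avoid_interval[OF assms(1) _ chk(1) assms(3,4)])
    show "odd (2 * n + 3)" by simp
    show "10 ^ 6 + 1 < int (2 * n + 3) ^ e" using chk(2) unfolding M_def .
    show "[w ^ ((2 * n + 3 - 1) div 2) = -1] (mod int (2 * n + 3) ^ e)" using av(1) unfolding n M_def .
    show "\<not> [w ^ i = c] (mod int (2 * n + 3) ^ e)" if "0 < i" "i < (2 * n + 3 - 1) div 2" "\<bar>c\<bar> \<le> 10 ^ 6" for i c
      using av(2)[of "i - 1" c] that unfolding n M_def by simp
  qed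
  thus ?thesis by simp
qed

text \<open>The guards only pin down the simplifier's evaluation order: a state is rewritten
  further only after its window test has been evaluated to \<open>True\<close>.\<close>

definition guarded :: "bool \<Rightarrow> nat \<Rightarrow> doubles \<Rightarrow> windows \<Rightarrow> int \<Rightarrow> int \<Rightarrow> bool" where
  "guarded P n D W M t \<longleftrightarrow> P \<and> powers_avoid n D W M t"

definition guarded_windows :: "bool \<Rightarrow> windows \<Rightarrow> windows \<Rightarrow> int \<Rightarrow> bool" where
  "guarded_windows P a b t \<longleftrightarrow> in_windows (if P then a else b) t"

lemma guarded_simps:
  "guarded True 0 D W M (numeral m) \<longleftrightarrow> M dvd numeral m + 1"
  "guarded True (numeral k) D W M (numeral m) \<longleftrightarrow>
     guarded (in_windows W (numeral m)) (pred_numeral k) D W M (subset_sum m D)"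
  "in_windows (Window l u) t \<longleftrightarrow> l < t \<and> t < u"
  "in_windows (Split d a b) t \<longleftrightarrow> guarded_windows (t < d) a b t"
  "guarded_windows True a b t \<longleftrightarrow> in_windows a t"
  "guarded_windows False a b t \<longleftrightarrow> in_windows b t"
  by (simp_all add: guarded_def guarded_windows_def numeral_eq_Suc[of k] num_of_nat_numeral_eq)

lemma doubles_mod_numeral:
  "doubles_mod (numeral k) M a =
     More a (doubles_mod (pred_numeral k) M (if a + a < M then a + a else a + a - M))"
  by (simp add: numeral_eq_Suc)

lemma teichmueller_check_guarded:
  "teichmueller_check (numeral n) (numeral e) w \<longleftrightarrow>
     lifts_avoid (numeral n) (numeral (Num.pow (num.Bit0 n + num.Bit1 num.One) e)) w"
  "lifts_avoid k (numeral m) w \<longleftrightarrow> 1000001 < (numeral m :: int) \<and>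
     guarded True k (doubles_mod 45 (numeral m) w) (window_tree (numeral m)
       [32 * numeral m, 16 * numeral m, 8 * numeral m, 4 * numeral m, 2 * numeral m, numeral m] 0)
     (numeral m) w"
proof -
  have M: "int (2 * numeral n + 3) ^ numeral e = numeral (Num.pow (num.Bit0 n + num.Bit1 num.One) e)"
  proof -
    have "numeral (num.Bit0 n + num.Bit1 num.One) = numeral (num.Bit0 n) + (3 :: int)"
      by (rule numeral_add)
    also have "numeral (num.Bit0 n) = 2 * (numeral n :: int)"
      by (simp only: numeral_Bit0[of n] mult_2)
    finally have "int (2 * numeral n + 3) = numeral (num.Bit0 n + num.Bit1 num.One)" by simp
    thus ?thesis by (simp only: power_numeral)
  qed
  show "teichmueller_check (numeral n) (numeral e) w \<longleftrightarrow>
     lifts_avoid (numeral n) (numeral (Num.pow (num.Bit0 n + num.Bit1 num.One) e)) w"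
    unfolding teichmueller_check_def M by (simp only: zero_less_numeral simp_thms)
next
  have B: "10 ^ 6 + 1 = (1000001 :: int)" by simp
  show "lifts_avoid k (numeral m) w \<longleftrightarrow> 1000001 < (numeral m :: int) \<and>
     guarded True k (doubles_mod 45 (numeral m) w) (window_tree (numeral m)
       [32 * numeral m, 16 * numeral m, 8 * numeral m, 4 * numeral m, 2 * numeral m, numeral m] 0)
     (numeral m) w"
    unfolding lifts_avoid_def B guarded_def by (simp only: simp_thms)
qed

lemma window_tree_numeral:
  "window_tree (numeral m) [] c = Window (c + 1000000) (c + (numeral m - 1000000))"
  by simp

text \<open>Evaluation has two phases: \<open>check_init\<close> computes modulus, table and tree
  once, and \<open>check_loop\<close> runs through the powers with additions and comparisons of
  numerals only.\<close>

lemmas check_init = teichmueller_check_guarded doubles_mod_numeral doubles_mod.simps(1)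
  window_tree_numeral window_tree.simps(2) if_True if_False
  pow.simps sqr.simps mult_num_simps numeral_times_numeral numeral_plus_numeral add_0_left add_num_simps
  diff_numeral_simps sub_num_simps dbl_simps dbl_inc_simps dbl_dec_simps
  less_num_simps le_num_simps numeral_less_iff pred_numeral_simps BitM.simps simp_thms

lemmas check_loop = guarded_simps subset_sum.simps numeral_plus_numeral add_num_simps
  less_num_simps le_num_simps numeral_less_iff pred_numeral_simps BitM.simps simp_thms

section \<open>Lifts for individual primes\<close>

text \<open>An entry \<open>(n, e, w)\<close> stands for the prime \<open>p = 2 n + 3\<close> and the lift \<open>w\<close> modulo \<open>p\<^sup>e\<close> of a primitive root
  to a root of unity of order \<open>p - 1\<close>.\<close>

definition lift_table :: "(nat \<times> nat \<times> int) list" where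
  "lift_table = [
     (10, 6, 15343673), (13, 5, 14143157), (14, 5, 2754849), (17, 5, 44010688),
     (19, 6, 655701690), (20, 5, 110045345), (22, 5, 57731985), (25, 5, 59032144),
     (28, 5, 238365902), (29, 5, 109781336), (32, 5, 1108052635), (34, 5, 1587260529),
     (35, 5, 1301332534), (38, 4, 1697871), (40, 4, 4320484), (43, 5, 878009656),
     (47, 4, 30104731), (49, 5, 6523027634), (50, 5, 9336681999), (52, 5, 5223609034),
     (53, 5, 11407806481), (55, 4, 146627786), (64, 4, 240704642), (67, 5, 10802974576),
     (73, 4, 39302179), (82, 4, 473790194), (85, 4, 78474878), (88, 5, 75564006375),
     (94, 4, 51702955), (97, 4, 31698287), (112, 4, 2604727619), (115, 4, 164406434),
     (118, 4, 1799916177), (124, 4, 2815300342), (127, 4, 4136615463), (130, 4, 1167746305),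
     (133, 4, 677004676), (139, 4, 2340510542), (145, 4, 1532278662), (154, 4, 9110868795),
     (157, 4, 439147393), (172, 4, 8058596142), (175, 4, 5996374644), (178, 4, 3376487270),
     (190, 4, 4743786683), (193, 4, 15203930408), (208, 4, 1025893848), (220, 4, 27475377426),
     (223, 4, 13355579088), (232, 4, 45132105877), (238, 4, 44611041355),
     (250, 4, 42332273775), (253, 4, 29610948261), (277, 4, 47789766730),
     (280, 4, 94871204881), (283, 4, 24614725490), (292, 4, 88646244078),
     (295, 4, 26498802154), (298, 4, 100722260322), (322, 4, 71151208537),
     (325, 3, 232914001), (337, 3, 181478653), (340, 4, 103421577067), (358, 4, 207990603039),
     (385, 4, 297330612830), (397, 4, 274755106864), (403, 3, 457759709),
     (418, 4, 60825888292), (427, 3, 473579060), (430, 4, 338543077768), (442, 3, 238497452),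
     (463, 4, 733739321336), (487, 3, 740403821), (490, 4, 238566162280)]"

text \<open>The primes 7, 11, 13, 17 and 19. Exponent 8 at 7 bounds the sum of two depths by 14,
  which is \<open>2 * p\<close> as needed in \<open>cascade_bound\<close>; exponent 7 at 13, 17 and
  19 bounds it by 12, less than the prime.\<close>

lemma check_small:
  "teichmueller_check 2 8 2387948"
  "teichmueller_check 4 8 181048540"
  "teichmueller_check 5 7 24995687"
  "teichmueller_check 7 7 112184244"
  "teichmueller_check 8 7 504505197"
  by - (simp only: check_init cong: if_weak_cong, simp only: check_loop, simp)+

lemma check_lifts_1:
  "teichmueller_check 10 6 15343673"
  "teichmueller_check 13 5 14143157"
  "teichmueller_check 14 5 2754849"
  "teichmueller_check 17 5 44010688"
  "teichmueller_check 19 6 655701690"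
  "teichmueller_check 20 5 110045345"
  "teichmueller_check 22 5 57731985"
  "teichmueller_check 25 5 59032144"
  "teichmueller_check 28 5 238365902"
  "teichmueller_check 29 5 109781336"
  "teichmueller_check 32 5 1108052635"
  "teichmueller_check 34 5 1587260529"
  "teichmueller_check 35 5 1301332534"
  "teichmueller_check 38 4 1697871"
  "teichmueller_check 40 4 4320484"
  "teichmueller_check 43 5 878009656"
  "teichmueller_check 47 4 30104731"
  "teichmueller_check 49 5 6523027634"
  "teichmueller_check 50 5 9336681999"
  "teichmueller_check 52 5 5223609034"
  "teichmueller_check 53 5 11407806481"
  "teichmueller_check 55 4 146627786"
  "teichmueller_check 64 4 240704642"
  "teichmueller_check 67 5 10802974576"
  "teichmueller_check 73 4 39302179"
  "teichmueller_check 82 4 473790194"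
  "teichmueller_check 85 4 78474878"
  "teichmueller_check 88 5 75564006375"
  "teichmueller_check 94 4 51702955"
  "teichmueller_check 97 4 31698287"
  "teichmueller_check 112 4 2604727619"
  by - (simp only: check_init cong: if_weak_cong, simp only: check_loop, simp)+

lemma check_lifts_2:
  "teichmueller_check 115 4 164406434"
  "teichmueller_check 118 4 1799916177"
  "teichmueller_check 124 4 2815300342"
  "teichmueller_check 127 4 4136615463"
  "teichmueller_check 130 4 1167746305"
  "teichmueller_check 133 4 677004676"
  "teichmueller_check 139 4 2340510542"
  "teichmueller_check 145 4 1532278662"
  "teichmueller_check 154 4 9110868795"
  "teichmueller_check 157 4 439147393"
  "teichmueller_check 172 4 8058596142"
  "teichmueller_check 175 4 5996374644"
  by - (simp only: check_init cong: if_weak_cong, simp only: check_loop, simp)+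

lemma check_lifts_3:
  "teichmueller_check 178 4 3376487270"
  "teichmueller_check 190 4 4743786683"
  "teichmueller_check 193 4 15203930408"
  "teichmueller_check 208 4 1025893848"
  "teichmueller_check 220 4 27475377426"
  "teichmueller_check 223 4 13355579088"
  "teichmueller_check 232 4 45132105877"
  "teichmueller_check 238 4 44611041355"
  by - (simp only: check_init cong: if_weak_cong, simp only: check_loop, simp)+

lemma check_lifts_4:
  "teichmueller_check 250 4 42332273775"
  "teichmueller_check 253 4 29610948261"
  "teichmueller_check 277 4 47789766730"
  "teichmueller_check 280 4 94871204881"
  "teichmueller_check 283 4 24614725490"
  "teichmueller_check 292 4 88646244078"
  by - (simp only: check_init cong: if_weak_cong, simp only: check_loop, simp)+

lemma check_lifts_5:
  "teichmueller_check 295 4 26498802154"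
  "teichmueller_check 298 4 100722260322"
  "teichmueller_check 322 4 71151208537"
  "teichmueller_check 325 3 232914001"
  "teichmueller_check 337 3 181478653"
  by - (simp only: check_init cong: if_weak_cong, simp only: check_loop, simp)+

lemma check_lifts_6:
  "teichmueller_check 340 4 103421577067"
  "teichmueller_check 358 4 207990603039"
  "teichmueller_check 385 4 297330612830"
  "teichmueller_check 397 4 274755106864"
  "teichmueller_check 403 3 457759709"
  by - (simp only: check_init cong: if_weak_cong, simp only: check_loop, simp)+

lemma check_lifts_7:
  "teichmueller_check 418 4 60825888292"
  "teichmueller_check 427 3 473579060"
  "teichmueller_check 430 4 338543077768"
  "teichmueller_check 442 3 238497452"
  by - (simp only: check_init cong: if_weak_cong, simp only: check_loop, simp)+

lemma check_lifts_8:
  "teichmueller_check 463 4 733739321336"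
  "teichmueller_check 487 3 740403821"
  "teichmueller_check 490 4 238566162280"
  by - (simp only: check_init cong: if_weak_cong, simp only: check_loop, simp)+

lemma lift_table_check: "(n, e, w) \<in> set lift_table \<Longrightarrow> teichmueller_check n e w"
  using check_lifts_1 check_lifts_2 check_lifts_3 check_lifts_4 check_lifts_5 check_lifts_6 check_lifts_7 check_lifts_8
  unfolding lift_table_def by auto

section \<open>Bounds for Fermat depths\<close>

lemma fermat_depth_dvd: "int p ^ fermat_depth p x dvd x ^ (p - 1) - 1"
  unfolding fermat_depth_def by (rule multiplicity_dvd)

lemma fermat_depth_less:
  assumes "\<not> int p ^ e dvd x ^ (p - 1) - 1"
  shows "fermat_depth p x < e"
  using assms fermat_depth_dvd[of p x] le_imp_power_dvd[of e "fermat_depth p x" "int p"]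
  by (meson dvd_trans not_le)

text \<open>With \<open>c\<close> the power of \<open>x\<close> to half of \<open>p - 1\<close>, the
  odd prime \<open>p\<close> divides at most one of \<open>c - 1\<close> and \<open>c + 1\<close>,
  so the whole power of \<open>p\<close> divides one of them.\<close>

lemma fermat_depth_le_half:
  assumes "prime p" "odd p" "2 \<le> x"
  shows "int p ^ fermat_depth p x \<le> 2 * x ^ ((p - 1) div 2)"
proof -
  have p: "prime (int p)" using assms by simp
  have p2: "p > 2" using assms(1,2) prime_gt_1_nat[of p] by (cases "p = 2") auto
  define n c where "n = (p - 1) div 2" and "c = x ^ n"
  have n: "p - 1 = n * 2" "n > 0" unfolding n_def using assms(2) p2 by auto
  have c: "c \<ge> 2" unfolding c_def using assms(3) n(2) by (rule power_ge_two)
  define P where "P = int p ^ fermat_depth p x"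
  have "P dvd c ^ 2 - 1"
    using fermat_depth_dvd[of p x] unfolding P_def c_def n(1) by (simp only: power_mult)
  also have "c ^ 2 - 1 = (c - 1) * (c + 1)" by (simp add: power2_eq_square algebra_simps)
  finally have "P dvd (c - 1) * (c + 1)" .
  moreover have "\<not> (int p dvd c - 1 \<and> int p dvd c + 1)"
  proof
    assume "int p dvd c - 1 \<and> int p dvd c + 1"
    hence "int p dvd (c + 1) - (c - 1)" using dvd_diff by blast
    thus False using p2 zdvd_imp_le[of "int p" 2] by simp
  qed
  hence "coprime P (c - 1) \<or> coprime P (c + 1)" unfolding P_def using p
    by (meson coprime_power_left_iff prime_imp_coprime)
  ultimately have "P dvd c - 1 \<or> P dvd c + 1"
    by (metis coprime_dvd_mult_left_iff coprime_dvd_mult_right_iff)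
  hence "P \<le> c + 1" using zdvd_imp_le[of P "c - 1"] zdvd_imp_le[of P "c + 1"] c by linarith
  thus ?thesis using c unfolding P_def c_def n_def by linarith
qed

lemma geometric_sum_le:
  fixes c :: int
  assumes "2 \<le> c" "0 < r"
  shows "(\<Sum>i<r. c ^ i) \<le> 2 * c ^ (r - 1)"
  using assms(2)
proof (induction r rule: nat_induct_non_zero)
  case (Suc r)
  have "2 * c ^ (r - 1) \<le> c * c ^ (r - 1)" using assms(1) by (intro mult_right_mono) auto
  also have "\<dots> = c ^ r" using Suc.hyps by (simp add: power_eq_if)
  finally show ?case using Suc.IH by simp
qed simp

text \<open>Let \<open>c\<close> be \<open>x\<close> to the power \<open>(p - 1) / 2r\<close>. A power of \<open>p\<close> dividing \<open>c\<^sup>2\<^sup>r - 1\<close> divides a single one of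
  the four factors \<open>c - 1\<close>, \<open>c + 1\<close>, \<open>(c\<^sup>r - 1) / (c - 1)\<close> and \<open>(c\<^sup>r + 1) / (c + 1)\<close>.\<close>

lemma fermat_depth_le_factor:
  assumes "prime p" "odd p" "2 \<le> x" "prime r" "odd r" "r dvd p - 1"
  shows "int p ^ fermat_depth p x \<le> 2 * x ^ ((p - 1) div (2 * r) * (r - 1))"
proof -
  have p: "prime (int p)" using assms by simp
  have p2: "p > 2" using assms(1,2) prime_gt_1_nat[of p] by (cases "p = 2") auto
  have r2: "r > 2" using assms(4,5) prime_gt_1_nat[of r] by (cases "r = 2") auto
  have rp: "r < p" using assms(6) p2 dvd_imp_le[of r "p - 1"] by simp
  define n c where "n = (p - 1) div (2 * r)" and "c = x ^ n"
  have "2 * r dvd p - 1" using assms(2,5,6) p2 by (intro divides_mult) auto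
  hence n: "p - 1 = n * r * 2" unfolding n_def by auto
  hence n0: "n > 0" using p2 by (intro Nat.gr0I) auto
  have c: "c \<ge> 2" unfolding c_def using assms(3) n0 by (rule power_ge_two)
  define P where "P = int p ^ fermat_depth p x"
  have factor: "P dvd a \<or> P dvd b" if "P dvd a * b" "\<not> (int p dvd a \<and> int p dvd b)" for a b
  proof -
    have "coprime P a \<or> coprime P b" unfolding P_def using p that(2)
      by (meson coprime_power_left_iff prime_imp_coprime)
    thus ?thesis using that(1) by (metis coprime_dvd_mult_left_iff coprime_dvd_mult_right_iff)
  qed
  define S where "S z = (\<Sum>i<r. z ^ i)" for z :: int
  have S: "z ^ r - 1 = (z - 1) * S z" for z by (simp add: S_def power_diff_1_eq)
  have not_both: "\<not> (int p dvd z - 1 \<and> int p dvd S z)" for z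
  proof -
    have "\<not> p dvd r" using rp r2 dvd_imp_le[of p r] by linarith
    thus ?thesis using prime_not_dvd_geometric_sum[OF assms(1), of z r] unfolding S_def by blast
  qed
  have "P dvd (c ^ r) ^ 2 - 1"
    using fermat_depth_dvd[of p x] unfolding P_def c_def n by (simp only: power_mult)
  also have "(c ^ r) ^ 2 - 1 = (c ^ r - 1) * (c ^ r + 1)" by (simp add: power2_eq_square algebra_simps)
  finally have "P dvd (c ^ r - 1) * (c ^ r + 1)" .
  moreover have "\<not> (int p dvd c ^ r - 1 \<and> int p dvd c ^ r + 1)"
  proof
    assume "int p dvd c ^ r - 1 \<and> int p dvd c ^ r + 1"
    hence "int p dvd (c ^ r + 1) - (c ^ r - 1)" using dvd_diff by blast
    thus False using p2 zdvd_imp_le[of "int p" 2] by simp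
  qed
  ultimately have "P dvd c ^ r - 1 \<or> P dvd c ^ r + 1" by (rule factor)
  \<comment> \<open>As \<open>r\<close> is odd, the factor with the plus sign is the other one taken
    at \<open>- c\<close>, so \<open>S\<close> serves both.\<close>
  moreover have "c ^ r + 1 = - ((- c) ^ r - 1)" using assms(5) by simp
  ultimately have "P dvd c ^ r - 1 \<or> P dvd (- c) ^ r - 1" by (metis dvd_minus_iff)
  hence "P dvd c - 1 \<or> P dvd S c \<or> P dvd - c - 1 \<or> P dvd S (- c)"
    unfolding S using factor not_both by blast
  moreover have "\<bar>z\<bar> \<le> 2 * c ^ (r - 1) \<and> z \<noteq> 0" if "z \<in> {c - 1, S c, - c - 1, S (- c)}" for z
  proof -
    have c1: "c \<le> c ^ (r - 1)" using c r2 self_le_power[of c "r - 1"] by simp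
    have Sc: "S c \<le> 2 * c ^ (r - 1)" unfolding S_def by (rule geometric_sum_le) (use c r2 in auto)
    have S1: "S c > 0" unfolding S_def by (rule sum_pos) (use c r2 in auto)
    have "\<bar>S (- c)\<bar> \<le> (\<Sum>i<r. \<bar>(- c) ^ i\<bar>)" unfolding S_def by (rule sum_abs)
    also have "\<dots> = S c" unfolding S_def using c by (intro sum.cong) (auto simp: power_abs)
    finally have "\<bar>S (- c)\<bar> \<le> 2 * c ^ (r - 1)" using Sc by linarith
    moreover have "S (- c) \<noteq> 0"
    proof
      assume "S (- c) = 0"
      hence "(- c) ^ r = 1" using S[of "- c"] by simp
      hence "c ^ r = -1" using assms(5) by simp
      thus False using c by (smt (verit) zero_le_power)
    qed
    ultimately show ?thesis using that Sc S1 c c1 by auto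
  qed
  ultimately obtain z where "P dvd z" "\<bar>z\<bar> \<le> 2 * c ^ (r - 1)" "z \<noteq> 0" by blast
  hence "P \<le> 2 * c ^ (r - 1)" using dvd_imp_le_int[of z P] by (simp add: P_def)
  thus ?thesis unfolding P_def c_def n_def by (simp only: power_mult)
qed

text \<open>Multiplying the bounds for 2 and \<open>b\<close> gives \<open>4 * (2 * b) ^ m\<close>,
  where \<open>2 * b \<le> 2000000\<close>; the factor 4 is absorbed since
  \<open>p > 4\<close>.\<close>

lemma depth_sum_le:
  assumes "p > 4" "2 \<le> b" "b \<le> 10 ^ 6" "2000000 ^ m \<le> int p ^ d"
    and "\<And>x. 2 \<le> x \<Longrightarrow> int p ^ fermat_depth p x \<le> 2 * x ^ m"
  shows "fermat_depth p 2 + fermat_depth p b \<le> d"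
proof -
  have "int p ^ (fermat_depth p 2 + fermat_depth p b) \<le> (2 * 2 ^ m) * (2 * b ^ m)"
    unfolding power_add using assms(2,5) by (intro mult_mono) auto
  also have "\<dots> = 4 * (2 * b) ^ m" by (simp add: power_mult_distrib)
  also have "\<dots> \<le> 4 * 2000000 ^ m" using assms(2,3) by (intro mult_left_mono power_mono) auto
  also have "\<dots> \<le> 4 * int p ^ d" using assms(4) by simp
  also have "4 * int p ^ d < int p ^ Suc d" using assms(1) by simp
  finally have "fermat_depth p 2 + fermat_depth p b < Suc d"
    by (rule power_less_imp_less_exp[rotated]) (use assms(1) in simp)
  thus ?thesis by simp
qed

section \<open>Depths at the primes from 23 on\<close>

text \<open>A pair \<open>(r, m)\<close> below satisfies \<open>2000000\<close> to the power \<open>r - 1\<close> \<open>\<le>\<close> \<open>m\<close> to the power \<open>2 r\<close>, which makes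
  the bound of \<open>fermat_depth_le_factor\<close> conclusive for primes \<open>q \<ge> m\<close> with \<open>r\<close> dividing \<open>q - 1\<close>.\<close>

definition covered :: "int \<Rightarrow> bool" where
  "covered q \<longleftrightarrow> q mod 3 = 0 \<or>
     list_ex (\<lambda>(r, m). m \<le> q \<and> q mod r = 1)
       [(3, 127), (5, 337), (7, 504), (11, 733), (13, 812), (17, 923), (19, 966)] \<or>
     list_ex (\<lambda>d. d < q \<and> q mod d = 0) [5, 7, 11, 13, 17, 19, 23, 29, 31, 37] \<or>
     q \<in> set [1019, 1049, 1097, 1109, 1187, 1193, 1229, 1283, 1307, 1319, 1367] \<or>
     q \<in> set (map (\<lambda>(n, e, w). 2 * int n + 3) lift_table)"

text \<open>The table is reduced to its primes, so that the evaluation handles lists of plain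
  integers.\<close>

lemma covered_code [code]:
  "covered q \<longleftrightarrow> q mod 3 = 0 \<or>
     list_ex (\<lambda>(r, m). m \<le> q \<and> q mod r = 1)
       [(3, 127), (5, 337), (7, 504), (11, 733), (13, 812), (17, 923), (19, 966)] \<or>
     list_ex (\<lambda>d. d < q \<and> q mod d = 0) [5, 7, 11, 13, 17, 19, 23, 29, 31, 37] \<or>
     List.member [1019, 1049, 1097, 1109, 1187, 1193, 1229, 1283, 1307, 1319, 1367] q \<or>
     List.member [
       23, 29, 31, 37, 41, 43, 47, 53, 59, 61, 67, 71, 73, 79, 83, 89, 97, 101, 103, 107, 109,
       113, 131, 137, 149, 167, 173, 179, 191, 197, 227, 233, 239, 251, 257, 263, 269, 281,
       293, 311, 317, 347, 353, 359, 383, 389, 419, 443, 449, 467, 479, 503, 509, 557, 563,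
       569, 587, 593, 599, 647, 653, 677, 683, 719, 773, 797, 809, 839, 857, 863, 887, 929,
       977, 983] q"
  by (simp add: covered_def lift_table_def)

text \<open>These are the odd numbers from 23 to 1413. A composite one has a prime factor of at most
  37, since \<open>41^2 > 1413\<close>.\<close>

lemma covered_range: "list_all (\<lambda>n. covered (2 * n + 3)) [10..705]"
  by code_simp

text \<open>At these primes 2 has depth at most 1, so the size bound is spent on \<open>b\<close>
  alone.\<close>

lemma not_wieferich:
  assumes "q \<in> set [1019, 1049, 1097, 1109, 1187, 1193, 1229, 1283, 1307, 1319, 1367 :: nat]"
  shows "\<not> int q ^ 2 dvd 2 ^ (q - 1) - 1"
proof -
  have "\<forall>q \<in> set [1019, 1049, 1097, 1109, 1187, 1193, 1229, 1283, 1307, 1319, 1367 :: nat].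
      mod_exp 2 (q - 1) (int q ^ 2) \<noteq> 1 mod int q ^ 2"
    by simp
  hence "mod_exp 2 (q - 1) (int q ^ 2) \<noteq> 1 mod int q ^ 2" using assms by blast
  thus ?thesis unfolding mod_exp_def by (simp add: mod_eq_dvd_iff)
qed

text \<open>Absorbs the factor 2 of \<open>fermat_depth_le_half\<close>; 1000 is the square root of
  the bound on \<open>b\<close>.\<close>

lemma two_mult_power_less:
  assumes "1009 \<le> q" "1000 \<le> n"
  shows "2 * 1000 ^ n < (int q) ^ n"
proof -
  have "real 2 \<le> 1 + real n * (9 / 1000)" using assms by simp
  also have "\<dots> \<le> (1 + 9 / 1000) ^ n" by (rule Bernoulli_inequality) simp
  finally have "2 * 1000 ^ n \<le> (1 + 9 / 1000) ^ n * (1000 :: real) ^ n"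
    by (intro mult_right_mono) auto
  also have "\<dots> = 1009 ^ n" by (simp flip: power_mult_distrib)
  finally have "2 * 1000 ^ n \<le> (1009 :: real) ^ n" .
  hence "real_of_int (2 * 1000 ^ n) \<le> real_of_int (1009 ^ n)" by simp
  hence "2 * 1000 ^ n \<le> (1009 :: int) ^ n" by (simp only: of_int_le_iff)
  \<comment> \<open>Bernoulli's inequality is used in its weak form, and parity excludes
    equality.\<close>
  moreover have "(2 :: int) * 1000 ^ n \<noteq> 1009 ^ n"
  proof
    assume "(2 :: int) * 1000 ^ n = 1009 ^ n"
    hence "even ((1009 :: int) ^ n)" by (metis dvd_triv_left)
    thus False by simp
  qed
  moreover have "(1009 :: int) ^ n \<le> int q ^ n" using assms by (intro power_mono) auto
  ultimately show ?thesis by linarith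
qed

lemma depth_sum_le_of_check:
  assumes "prime (2 * n + 3)" "teichmueller_check n e w" "2 \<le> b" "b \<le> 10 ^ 6"
  shows "fermat_depth (2 * n + 3) 2 + fermat_depth (2 * n + 3) b \<le> 2 * (e - 1)"
proof -
  have "fermat_depth (2 * n + 3) x < e" if "2 \<le> x" "x \<le> 10 ^ 6" for x
    using teichmueller_check_imp_not_dvd[OF assms(1,2) that] by (intro fermat_depth_less) simp
  from this[of 2] this[of b] show ?thesis using assms(3,4) by simp
qed

lemma depth_sum_less_of_factor:
  assumes "prime q" "odd q" "5 \<le> q" "prime r" "odd r" "q mod r = 1" "m \<le> q"
    and m: "(2000000 :: nat) ^ (r - 1) \<le> m ^ (2 * r)" and "2 \<le> b" "b \<le> 10 ^ 6"
  shows "fermat_depth q 2 + fermat_depth q b < q"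
proof -
  have r: "r dvd q - 1" using assms(3,6) by (metis dvd_minus_mod)
  define n where "n = (q - 1) div (2 * r)"
  have "2 * r dvd q - 1" using assms(2,3,5) r by (intro divides_mult) auto
  hence n: "q - 1 = 2 * r * n" by (simp add: n_def)
  have "(2000000 :: nat) ^ ((r - 1) * n) \<le> (m ^ (2 * r)) ^ n"
    unfolding power_mult[of _ "r - 1"] by (intro power_mono m) simp
  also have "\<dots> \<le> (q ^ (2 * r)) ^ n" using assms(7) by (intro power_mono) auto
  also have "\<dots> = q ^ (q - 1)" unfolding n by (simp only: power_mult)
  finally have "(2000000 :: nat) ^ (n * (r - 1)) \<le> q ^ (q - 1)" by (simp only: mult.commute)
  hence "int (2000000 ^ (n * (r - 1))) \<le> int (q ^ (q - 1))" by (simp only: of_nat_le_iff)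
  hence "2000000 ^ (n * (r - 1)) \<le> int q ^ (q - 1)" by simp
  from depth_sum_le[OF _ assms(9,10) this] fermat_depth_le_factor[OF assms(1,2) _ assms(4,5) r] assms(3)
  have "fermat_depth q 2 + fermat_depth q b \<le> q - 1" unfolding n_def by simp
  thus ?thesis using assms(3) by linarith
qed

lemma depth_sum_less:
  assumes "prime q" "23 \<le> q" "2 \<le> b" "b \<le> 10 ^ 6"
  shows "fermat_depth q 2 + fermat_depth q b < q"
proof -
  have oddq: "odd q" using assms(1,2) by (intro prime_odd_nat) auto
  have square: "(z ^ 2) ^ ((q - 1) div 2) = z ^ (q - 1)" for z :: int
  proof -
    have "2 * ((q - 1) div 2) = q - 1" using oddq by simp
    thus ?thesis by (simp only: power_mult[symmetric])
  qed
  show ?thesis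
  proof (cases "q < 1415")
    case False
    \<comment> \<open>1415 is the least integer whose square reaches 2000000, and from there on the
      bound by half powers suffices.\<close>
    have "2000000 ^ ((q - 1) div 2) \<le> (int q ^ 2) ^ ((q - 1) div 2)"
    proof (rule power_mono)
      have "(1415 :: int) ^ 2 \<le> int q ^ 2" using False by (intro power_mono) auto
      thus "2000000 \<le> int q ^ 2" by simp
    qed simp
    also have "\<dots> = int q ^ (q - 1)" by (rule square)
    finally have "fermat_depth q 2 + fermat_depth q b \<le> q - 1"
      using depth_sum_le[OF _ assms(3,4)] fermat_depth_le_half[OF assms(1) oddq] assms(2) by simp
    thus ?thesis using assms(2) by linarith
  next
    case True
    define n where "n = (q - 3) div 2"
    have n: "q = 2 * n + 3" unfolding n_def using oddq assms(2) by presburger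
    hence "int n \<in> {10..705}" using True assms(2) by simp
    hence "covered (2 * int n + 3)" using covered_range by (simp only: list_all_iff set_upto)
    hence "covered (int q)" using n by simp
    moreover have md: "int q mod numeral c = int (q mod numeral c)" for c
      by (simp add: zmod_int)
    ultimately consider (factor) r m where
        "(r, m) \<in> set [(3, 127), (5, 337), (7, 504), (11, 733), (13, 812), (17, 923), (19, 966 :: nat)]"
        "m \<le> q" "q mod r = 1"
      | (divisor) d where "d \<in> set [3, 5, 7, 11, 13, 17, 19, 23, 29, 31, 37 :: nat]" "d < q" "q mod d = 0"
      | (wieferich) "q \<in> set [1019, 1049, 1097, 1109, 1187, 1193, 1229, 1283, 1307, 1319, 1367]"
      | (table) m e w where "(m, e, w) \<in> set lift_table" "q = 2 * m + 3"
    proof -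
      assume "covered (int q)"
      then consider (a) "q mod 3 = 0"
        | (b) "\<exists>(r, m)\<in>set [(3, 127), (5, 337), (7, 504), (11, 733), (13, 812), (17, 923), (19, 966 :: nat)].
            m \<le> q \<and> q mod r = 1"
        | (c) "\<exists>d\<in>set [5, 7, 11, 13, 17, 19, 23, 29, 31, 37 :: nat]. d < q \<and> q mod d = 0"
        | (d) "q \<in> set [1019, 1049, 1097, 1109, 1187, 1193, 1229, 1283, 1307, 1319, 1367]"
        | (e) "int q \<in> set (map (\<lambda>(n, e, w). 2 * int n + 3) lift_table)"
        unfolding covered_def by (simp add: md) metis
      thus thesis
      proof cases
        case a
        thus ?thesis using that(2)[of 3] assms(2) by simp
      next
        case e
        then obtain m e w where "(m, e, w) \<in> set lift_table" "int q = 2 * int m + 3" by auto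
        thus ?thesis using that(4)[of m e w] by linarith
      next
        case b
        then obtain x where x: "x \<in> set [(3, 127), (5, 337), (7, 504), (11, 733), (13, 812), (17, 923), (19, 966 :: nat)]"
          "case x of (r, m) \<Rightarrow> m \<le> q \<and> q mod r = 1" by (rule bexE)
        hence "snd x \<le> q" "q mod fst x = 1" by (simp_all only: case_prod_beta)
        thus ?thesis using that(1)[of "fst x" "snd x"] x(1) unfolding prod.collapse by blast
      next
        case c
        then obtain d where d: "d \<in> set [5, 7, 11, 13, 17, 19, 23, 29, 31, 37]" "d < q \<and> q mod d = 0" by (rule bexE)
        have "d \<in> set [3, 5, 7, 11, 13, 17, 19, 23, 29, 31, 37]"
          using d(1) unfolding list.set(2)[of 3] by (rule insertI2)
        thus ?thesis using d(2) that(2)[of d] by simp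
      next
        case d
        thus ?thesis by (rule that(3))
      qed
    qed
    thus ?thesis
    proof cases
      case factor
      have "prime r" "odd r" "(2000000 :: nat) ^ (r - 1) \<le> m ^ (2 * r)" using factor(1) by auto
      thus ?thesis using depth_sum_less_of_factor assms oddq factor(2,3) by simp
    next
      case divisor
      hence "d dvd q" by auto
      thus ?thesis using divisor(1,2) assms(1) by (auto simp: prime_nat_iff)
    next
      case wieferich
      have "fermat_depth q 2 < 2" using not_wieferich[OF wieferich] by (rule fermat_depth_less)
      moreover have "fermat_depth q b < q - 1"
      proof -
        have q1: "1009 \<le> q" "1000 \<le> q - 1" using wieferich by auto
        have "int q ^ fermat_depth q b \<le> 2 * b ^ ((q - 1) div 2)"
          by (rule fermat_depth_le_half[OF assms(1) oddq assms(3)])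
        also have "\<dots> \<le> 2 * (1000 ^ 2) ^ ((q - 1) div 2)"
          using assms(3,4) by (intro mult_left_mono power_mono) auto
        also have "\<dots> = 2 * 1000 ^ (q - 1)" by (simp only: square)
        also have "\<dots> < int q ^ (q - 1)" by (rule two_mult_power_less[OF q1])
        finally show ?thesis by (rule power_less_imp_less_exp[rotated]) (use q1 in simp)
      qed
      ultimately show ?thesis using assms(2) by linarith
    next
      case table
      have "teichmueller_check m e w" using table(1) by (rule lift_table_check)
      hence "fermat_depth q 2 + fermat_depth q b \<le> 2 * (e - 1)"
        using depth_sum_le_of_check[of m e w b] assms table(2) by simp
      moreover have "e \<le> 6" using table(1) unfolding lift_table_def by auto
      ultimately show ?thesis using assms(2) by linarith
    qed
  qed
qed

section \<open>The cascade of divisors of the exponent\<close>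

lemma power_gt_twice_mono:
  fixes B C :: int
  assumes "0 < C" "C \<le> B" "2 * C ^ i < B ^ i" "i \<le> j"
  shows "2 * C ^ j < B ^ j"
proof -
  have j: "j = i + (j - i)" using assms(4) by simp
  have "2 * C ^ i * C ^ (j - i) < B ^ i * C ^ (j - i)" using assms(1,3) by (intro mult_strict_right_mono) auto
  also have "\<dots> \<le> B ^ i * B ^ (j - i)" using assms(1,2) by (intro mult_left_mono power_mono) auto
  finally show ?thesis by (subst (1 2) j) (simp only: power_add mult.assoc)
qed

lemma fermat_depth_less_of_bound:
  assumes "prime p" "odd p" "2 \<le> x" "2 * x ^ ((p - 1) div 2) < int p ^ e"
  shows "fermat_depth p x < e"
proof (rule power_less_imp_less_exp)
  show "int p ^ fermat_depth p x < int p ^ e"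
    using fermat_depth_le_half[OF assms(1-3)] assms(4) by linarith
  show "1 < int p" using assms(1) prime_gt_1_nat by simp
qed

text \<open>Supplies the hypothesis of \<open>prime_power_dvd_exponent\<close>. If the depths add up
  to at most \<open>2 * p\<close>, then \<open>p + (v - 1) \<le> p ^ v\<close> absorbs the term in
  \<open>v\<close>; 3 and 5 are too small for this and are bounded by size.\<close>

lemma cascade_bound:
  assumes "prime p" "odd p" "1 \<le> v" "2 * p ^ v < q" "23 \<le> q" "2 \<le> b" "b \<le> 10 ^ 6"
  shows "fermat_depth p 2 + fermat_depth p b + 2 * (v - 1) < q"
proof -
  have p3: "p \<ge> 3" using assms(1,2) prime_ge_2_nat[of p] by (cases "p = 2") auto
  have grow: "p ^ i + j \<le> p ^ (i + j)" if "0 < i" for i j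
  proof (induction j)
    case (Suc j)
    have "p ^ (i + j) \<ge> 1" using p3 by simp
    moreover have "2 * p ^ (i + j) \<le> p * p ^ (i + j)" using p3 by (intro mult_right_mono) auto
    ultimately have "p ^ i + Suc j \<le> p * p ^ (i + j)" using Suc by linarith
    thus ?case by simp
  qed simp
  have g1: "2 * p + 2 * (v - 1) < q" using grow[of 1 "v - 1"] assms(3,4) by simp
  have "p = 3 \<or> p = 5 \<or> (7 \<le> p \<and> p < 23) \<or> 23 \<le> p" using p3 assms(2) by presburger
  then consider "p = 3" | "p = 5" | "7 \<le> p" "p < 23" | "23 \<le> p" by blast
  thus ?thesis
  proof cases
    case 1
    have "fermat_depth 3 2 < 2" by (rule fermat_depth_less_of_bound) auto
    \<comment> \<open>\<open>3 ^ 14\<close> is the first power of 3 above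
      \<open>2 * 10 ^ 6\<close>.\<close>
    moreover have "fermat_depth 3 b < 14" by (rule fermat_depth_less_of_bound) (use assms in auto)
    moreover have "14 + 2 * (v - 1) < q"
    proof (cases "v = 1")
      case False
      define u where "u = v - 2"
      have v: "v = 2 + u" unfolding u_def using False assms(3) by simp
      show ?thesis using grow[of 2 u] assms(4) unfolding 1 v by simp
    qed (use assms(5) in simp)
    ultimately show ?thesis unfolding 1 by linarith
  next
    case 2
    have "fermat_depth 5 2 < 2" by (rule fermat_depth_less_of_bound) auto
    moreover have "fermat_depth 5 b < 18"
    proof (rule fermat_depth_less_of_bound)
      have "b ^ 2 \<le> (10 ^ 6) ^ 2" using assms(6,7) by (intro power_mono) auto
      thus "2 * b ^ ((5 - 1) div 2) < int 5 ^ 18" by simp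
    qed (use assms in auto)
    moreover have "18 + 2 * (v - 1) < q"
    proof (cases "v = 1")
      case False
      define u where "u = v - 2"
      have v: "v = 2 + u" unfolding u_def using False assms(3) by simp
      show ?thesis using grow[of 2 u] assms(4) unfolding 2 v by simp
    qed (use assms(5) in simp)
    ultimately show ?thesis unfolding 2 by linarith
  next
    case 3
    have "fermat_depth p 2 + fermat_depth p b \<le> 2 * p"
    proof -
      have "\<not> 3 dvd p" using assms(1) 3 primes_dvd_imp_eq[of 3 p] by auto
      moreover have "p = 7 \<or> p = 9 \<or> p = 11 \<or> p = 13 \<or> p = 15 \<or> p = 17 \<or> p = 19 \<or> p = 21"
        using 3 assms(2) by presburger
      ultimately consider "p = 7" | "p = 11" | "p = 13" | "p = 17" | "p = 19" by fastforce
      thus ?thesis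
      proof cases
        case 1
        thus ?thesis using depth_sum_le_of_check[OF _ check_small(1), of b] assms(1,6,7) by simp
      next
        case 2
        thus ?thesis using depth_sum_le_of_check[OF _ check_small(2), of b] assms(1,6,7) by simp
      next
        case 3
        thus ?thesis using depth_sum_le_of_check[OF _ check_small(3), of b] assms(1,6,7) by simp
      next
        case 4
        thus ?thesis using depth_sum_le_of_check[OF _ check_small(4), of b] assms(1,6,7) by simp
      next
        case 5
        thus ?thesis using depth_sum_le_of_check[OF _ check_small(5), of b] assms(1,6,7) by simp
      qed
    qed
    thus ?thesis using g1 by linarith
  next
    case 4
    thus ?thesis using depth_sum_less[OF assms(1) 4 assms(6,7)] g1 by linarith
  qed
qed

section \<open>The contradiction at q and the descent through prime factors\<close>

context solution
begin

text \<open>By coprimality \<open>j = k / q\<close> is a multiple of \<open>q - 1\<close>, hence at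
  least \<open>q - 1\<close>. The size condition of \<open>no_power_product_solution\<close>
  persists as \<open>j\<close> grows, so it is checked at one small \<open>i \<le> j\<close>: 1, 4
  or 2, depending on \<open>q\<close>.\<close>

lemma exponent_not_divisible:
  assumes "q - 1 dvd k" "q dvd k"
  shows False
proof -
  obtain j where j: "k = q * j" using assms(2) by auto
  have q3: "q \<ge> 3" by (rule q_ge)
  have "coprime (q - 1) q" using q3 by (metis coprime_diff_one_left_nat less_le_trans zero_less_numeral)
  hence "q - 1 dvd j" using assms(1) j by (metis coprime_dvd_mult_right_iff)
  moreover have j0: "j > 0" using j k_ge by (intro Nat.gr0I) auto
  ultimately have jq: "q - 1 \<le> j" by (simp add: dvd_imp_le)
  define X Y where "X = (2::int) ^ j" and "Y = b ^ j"
  have XY: "X \<ge> 2" "Y \<ge> 2" unfolding X_def Y_def using j0 b_ge power_ge_two by auto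
  have eq': "(X ^ q - 1) * (Y ^ q - 1) = y ^ q"
    using eq unfolding X_def Y_def j by (simp add: power_mult[symmetric] mult.commute)
  have YX: "Y \<le> X ^ q"
  proof -
    have "Y \<le> (2 ^ q) ^ j" unfolding Y_def using b_ge b_less by (intro power_mono) auto
    thus ?thesis unfolding X_def by (simp add: power_mult[symmetric] mult.commute)
  qed
  have big: False if "0 < i" "i \<le> j" "2 ^ (q + 1) \<le> b ^ (q - 1)" "2 * (2 ^ (q + 1)) ^ i < (b ^ (q - 1)) ^ i" for i
  proof -
    have "2 * (2 ^ (q + 1)) ^ j < (b ^ (q - 1)) ^ j"
      by (rule power_gt_twice_mono[OF _ that(3,4,2)]) simp
    hence "2 * X ^ (q + 1) < Y ^ (q - 1)" unfolding X_def Y_def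
      by (simp only: power_mult[symmetric] mult.commute)
    thus False using no_power_product_solution[OF odd_q q3 XY _ eq' YX] y_ge by simp
  qed
  consider "q \<ge> 7" | "q = 5" | "q = 3" "b = 5" | "q = 3" "b = 3"
  proof (cases "q \<ge> 7")
    case False
    hence "q = 3 \<or> q = 5" using q3 odd_q by presburger
    moreover have "b \<in> {3, 5}" if "q = 3"
    proof -
      have "b \<in> {3..6}" using b_ge b_less that by simp
      hence "b \<in> {3, 4, 5, 6}" by auto
      thus ?thesis using odd_b by auto
    qed
    ultimately show ?thesis using that(2-4) by blast
  qed
  thus False
  proof cases
    case 1
    have "2 * 2 ^ (q + 1) < (3::int) ^ (q - 1)" using 1
    proof (induction q rule: dec_induct)
      case (step n)
      have "n - 1 + 1 = n" using step.hyps by simp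
      hence "(3::int) ^ n = 3 * 3 ^ (n - 1)" by (metis power_Suc Suc_eq_plus1)
      moreover have "(0::int) < 2 * 2 ^ (n + 1)" by simp
      ultimately have "2 * (2 * 2 ^ (n + 1)) < (3::int) ^ n" using step.IH by linarith
      thus ?case by simp
    qed simp
    also have "\<dots> \<le> b ^ (q - 1)" using b_ge by (intro power_mono) auto
    finally have l: "2 * 2 ^ (q + 1) < b ^ (q - 1)" .
    have "(0::int) \<le> 2 ^ (q + 1)" by simp
    hence "2 ^ (q + 1) \<le> b ^ (q - 1)" using l by linarith
    thus False using big[of 1] l j0 by simp
  next
    case 2
    have "(3::int) ^ 4 \<le> b ^ 4" using b_ge by (intro power_mono) auto
    hence a: "81 \<le> b ^ 4" by simp
    hence "81 ^ 4 \<le> (b ^ 4) ^ 4" by (intro power_mono) auto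
    thus False using big[of 4] jq a unfolding 2 by simp
  next
    case 3
    thus False using big[of 2] jq by simp
  next
    case 4
    \<comment> \<open>For \<open>q = b = 3\<close> that condition fails, as
      \<open>2 ^ 4 > 3 ^ 2\<close>. Instead \<open>y ^ 3\<close> is squeezed between the cubes of
      \<open>t - 1\<close> and \<open>t\<close>.\<close>
    define t where "t = (6::int) ^ j"
    have "(8 ^ j - 1) * (27 ^ j - 1) = y ^ 3"
      using eq' unfolding X_def Y_def 4 by (simp add: power_mult[symmetric] mult.commute[of _ 3] power_mult)
    moreover have "(8 ^ j) * (27 ^ j) = t ^ 3" unfolding t_def
      by (simp add: power_mult[symmetric] mult.commute[of _ 3] power_mult flip: power_mult_distrib)
    ultimately have y3: "y ^ 3 = t ^ 3 - 8 ^ j - 27 ^ j + 1" by (simp add: algebra_simps)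
    have t6: "t \<ge> 6" unfolding t_def using self_le_power[of 6 j] j0 by simp
    have l1: "(8::int) ^ j \<le> t ^ 2" "(27::int) ^ j \<le> t ^ 2"
    proof -
      have "t ^ 2 = 36 ^ j" unfolding t_def by (simp add: power_mult[symmetric] mult.commute[of _ 2] power_mult)
      thus "(8::int) ^ j \<le> t ^ 2" "(27::int) ^ j \<le> t ^ 2" by (auto intro: power_mono)
    qed
    have l2: "6 * t \<le> t ^ 2" using t6 by (simp add: power2_eq_square)
    have cube: "(t - 1) ^ 3 = t ^ 3 - 3 * t ^ 2 + 3 * t - 1"
      by (simp add: power3_eq_cube power2_eq_square algebra_simps)
    have "m - 3 * n + 3 * t - 1 < m - u - v + 1" if "u \<le> n" "v \<le> n" "6 * t \<le> n" for m n u v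
      using that t6 by linarith
    from this[OF l1 l2, of "t ^ 3"] have "(t - 1) ^ 3 < y ^ 3" unfolding y3 cube .
    moreover have "(0::int) \<le> y" using y_ge by simp
    ultimately have ty: "t - 1 < y" by (rule power_less_imp_less_base)
    have "m - u - v + 1 < m" if "1 < u" "1 < v" for m u v :: int
      using that by linarith
    moreover have "(1::int) < 8 ^ j" "(1::int) < 27 ^ j" using j0 by (auto intro: one_less_power)
    ultimately have "y ^ 3 < t ^ 3" unfolding y3 by blast
    moreover have "0 \<le> t" using t6 by simp
    ultimately have "y < t" by (rule power_less_imp_less_base)
    with ty show False by linarith
  qed
qed

text \<open>Otherwise the cascade step at \<open>p = q\<close> would give \<open>q dvd k\<close>. It
  remains to show \<open>q - 1 dvd k\<close> and to bound the depths at \<open>q\<close>.\<close>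

lemma depth_sum_ge:
  assumes "q - 1 dvd k"
  shows "q \<le> fermat_depth q 2 + fermat_depth q b"
proof (rule ccontr)
  assume "\<not> ?thesis"
  hence "q ^ 1 dvd k" using prime_power_dvd_exponent[OF prime_q odd_q assms, of 1] by simp
  thus False using exponent_not_divisible assms by simp
qed

text \<open>If not, \<open>2 ^ (q + 1 - v)\<close> divides \<open>b - 1\<close> or
  \<open>b + 1\<close>, both below \<open>2 ^ 20\<close>. Then \<open>v \<ge> q - 18\<close>, so
  \<open>2 ^ v\<close> exceeds \<open>q\<close>.\<close>

lemma two_power_dvd_k:
  assumes "b \<le> 10 ^ 6" "23 \<le> q" "2 ^ v \<le> q"
  shows "2 ^ v dvd k"
proof (cases "v = 0")
  case False
  have vq: "v < q" using assms(3) less_exp[of v] by linarith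
  have small: "\<not> 2 ^ (q + 1 - v) dvd z" if "0 < z" "z \<le> 10 ^ 6 + 1" for z :: int
  proof
    assume "2 ^ (q + 1 - v) dvd z"
    hence "2 ^ (q + 1 - v) \<le> z" using that(1) by (rule zdvd_imp_le)
    also have "\<dots> < 2 ^ 20" using that(2) by simp
    finally have "q + 1 - v < 20" by (rule power_less_imp_less_exp[rotated]) simp
    hence v: "q - 18 \<le> v" by simp
    have "n < 2 ^ (n - 18)" if "23 \<le> n" for n :: nat using that
    proof (induction n rule: dec_induct)
      case (step n)
      have "Suc n - 18 = Suc (n - 18)" using step.hyps by simp
      thus ?case using step by simp
    qed simp
    hence "q < 2 ^ (q - 18)" using assms(2) by blast
    also have "\<dots> \<le> (2::nat) ^ v" using v by (intro power_increasing) auto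
    finally show False using assms(3) by simp
  qed
  show ?thesis using two_power_dvd_exponent[of v] small[of "b - 1"] small[of "b + 1"] vq False assms(1) b_ge by auto
qed simp

text \<open>Strong induction on \<open>n\<close>: for an odd prime \<open>p\<close> dividing
  \<open>n\<close>, the smaller number \<open>p - 1\<close> inherits the hypotheses, because its
  prime powers are below \<open>p\<close>. So \<open>p - 1\<close> divides \<open>k\<close>, and the
  cascade step yields the power of \<open>p\<close>.\<close>

lemma dvd_exponent:
  assumes "b \<le> 10 ^ 6" "23 \<le> q" "0 < n" "n < q"
    and "\<And>p. prime p \<Longrightarrow> odd p \<Longrightarrow> p dvd n \<Longrightarrow> 2 * p ^ multiplicity p n < q"
  shows "n dvd k"
  using assms(3-)
proof (induction n rule: less_induct)
  case (less n)
  show ?case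
  proof (rule multiplicity_le_imp_dvd)
    show "n \<noteq> 0" using less.prems by simp
    fix p :: nat assume p: "prime p"
    show "multiplicity p n \<le> multiplicity p k"
    proof (cases "p dvd n")
      case True
      define v where "v = multiplicity p n"
      have v1: "1 \<le> v" unfolding v_def using True p less.prems(1)
        by (intro multiplicity_geI) (auto simp: not_prime_unit)
      have pn: "p ^ v dvd n" unfolding v_def by (rule multiplicity_dvd)
      have "p ^ v dvd k"
      proof (cases "p = 2")
        case 2: True
        have "2 ^ v \<le> q" using dvd_imp_le[OF pn less.prems(1)] less.prems(2) unfolding 2 by simp
        thus ?thesis unfolding 2 by (rule two_power_dvd_k[OF assms(1,2)])
      next
        case False
        hence oddp: "odd p" using p by (metis primes_dvd_imp_eq two_is_prime_nat)
        have p2: "2 * p ^ v < q" unfolding v_def by (rule less.prems(3)[OF p oddp True])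
        have pv: "p \<le> p ^ v" using v1 p prime_gt_0_nat[of p] by (intro self_le_power) auto
        have "p - 1 dvd k"
        proof (rule less.IH)
          have "p \<le> n" using True less.prems(1) by (rule dvd_imp_le)
          thus "p - 1 < n" using p prime_gt_1_nat[of p] by linarith
          show "0 < p - 1" using p prime_gt_1_nat[of p] by simp
          show "p - 1 < q" using p2 pv by linarith
          fix r :: nat assume r: "prime r" "odd r" "r dvd p - 1"
          have "r ^ multiplicity r (p - 1) \<le> p - 1"
            using p prime_gt_1_nat[of p] by (intro dvd_imp_le multiplicity_dvd) auto
          thus "2 * r ^ multiplicity r (p - 1) < q" using p2 pv by linarith
        qed
        thus ?thesis
          using prime_power_dvd_exponent[OF p oddp _ cascade_bound[OF p oddp v1 p2 assms(2) _ assms(1)]] b_ge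
          by simp
      qed
      thus ?thesis unfolding v_def using p k_ge
        by (intro multiplicity_geI) (auto simp: not_prime_unit)
    qed (simp add: not_dvd_imp_multiplicity_0)
  qed
qed

lemma q_less_23:
  assumes "b \<le> 10 ^ 6"
  shows "q < 23"
proof (rule ccontr)
  assume "\<not> q < 23"
  hence q: "23 \<le> q" by simp
  have "q - 1 dvd k"
  proof (rule dvd_exponent[OF assms q])
    fix p :: nat assume p: "prime p" "odd p" "p dvd q - 1"
    \<comment> \<open>As \<open>q - 1\<close> is even, its odd prime powers are at most half of
      it.\<close>
    have "p ^ multiplicity p (q - 1) * 2 dvd q - 1"
    proof (rule divides_mult)
      show "2 dvd q - 1" using odd_q by simp
      show "coprime (p ^ multiplicity p (q - 1)) 2" using p(2) by simp
    qed (rule multiplicity_dvd)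
    hence "p ^ multiplicity p (q - 1) * 2 \<le> q - 1" using q by (intro dvd_imp_le) auto
    thus "2 * p ^ multiplicity p (q - 1) < q" using q by linarith
  qed (use q in auto)
  thus False using depth_sum_ge depth_sum_less[OF prime_q q _ assms] b_ge by simp
qed

end

section \<open>Small exponents\<close>

context solution
begin

lemma contradiction_of_depths:
  assumes "q - 1 dvd k" "fermat_depth q 2 < i" "fermat_depth q b < j" "i + j < q + 2"
  shows False
  using depth_sum_ge[OF assms(1)] assms(2-) by linarith

lemma q_not_3: "q \<noteq> 3"
proof
  assume q: "q = 3"
  have "b \<in> set [3..6]" unfolding set_upto using b_ge b_less q by simp
  hence b: "b = 3 \<or> b = 5" using odd_b by (auto simp: upto.simps)
  have "fermat_depth q 2 < 2" unfolding q by (rule fermat_depth_less) simp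
  moreover have "fermat_depth q b < 2" unfolding q by (rule fermat_depth_less) (use b in auto)
  moreover have "q - 1 dvd k" unfolding q using even_k by simp
  ultimately show False using contradiction_of_depths[of 2 2] q by simp
qed

lemma q_eq_5:
  assumes "q = 5"
  shows "b \<in> {15, 17}"
proof (rule ccontr)
  assume b: "b \<notin> {15, 17}"
  have b30: "b \<in> set [3..30]" unfolding set_upto using b_ge b_less assms by simp
  \<comment> \<open>Here 16 is \<open>2 ^ (q + 1 - v)\<close> for \<open>v = 2\<close>.\<close>
  have "\<forall>x\<in>set [3..30]. 16 dvd x - 1 \<or> 16 dvd x + 1 \<longrightarrow> x \<in> {15, 17 :: int}"
    by (simp add: upto.simps)
  hence "4 dvd k" using two_power_dvd_exponent[of 2] b b30 assms by auto
  moreover have "fermat_depth q 2 < 2" unfolding assms by (rule fermat_depth_less) simp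
  moreover have "fermat_depth q b < 4" unfolding assms
  proof (rule fermat_depth_less)
    have "\<forall>x\<in>set [3..30]. \<not> 625 dvd x ^ 4 - (1 :: int)" by (simp add: upto.simps)
    hence "\<not> 625 dvd b ^ 4 - 1" using b30 by (rule bspec)
    thus "\<not> int 5 ^ 4 dvd b ^ (5 - 1) - 1" by simp
  qed
  ultimately show False using contradiction_of_depths[of 2 4] assms by simp
qed

text \<open>The cascade can always start at 3, since \<open>k\<close> is even; 2 has depth 1
  there.\<close>

lemma three_depths:
  assumes "2 * b < 3 ^ e" "e + 2 * v < q + 2" "1 \<le> v"
  shows "3 ^ v dvd k"
proof (rule prime_power_dvd_exponent)
  have "fermat_depth 3 2 < 2" by (rule fermat_depth_less) simp
  moreover have "fermat_depth 3 b < e"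
    by (rule fermat_depth_less_of_bound) (use assms b_ge in auto)
  ultimately show "fermat_depth 3 2 + fermat_depth 3 b + 2 * (v - 1) < q"
    using assms by linarith
qed (use even_k in auto)

lemma q_not_7: "q \<noteq> 7"
proof
  assume q: "q = 7"
  have b: "b \<le> 126" using b_less q by simp
  have "3 ^ 1 dvd k" by (rule three_depths[of 6]) (use b q in auto)
  hence "2 * 3 dvd k" using even_k by (intro divides_mult) auto
  moreover have "fermat_depth q 2 < 2" unfolding q by (rule fermat_depth_less) simp
  \<comment> \<open>The bound \<open>2 * b ^ 3\<close> by half powers is too weak here; splitting
    off \<open>r = 3\<close> improves it to \<open>2 * b ^ 2\<close>.\<close>
  moreover have "fermat_depth q b < 6"
  proof (rule power_less_imp_less_exp)
    have "int q ^ fermat_depth q b \<le> 2 * b ^ ((q - 1) div (2 * 3) * (3 - 1))"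
      by (rule fermat_depth_le_factor) (use prime_q odd_q b_ge q in auto)
    also have "\<dots> = 2 * b ^ 2" by (simp add: q)
    also have "\<dots> \<le> 2 * 126 ^ 2" using b b_ge by (intro mult_left_mono power_mono) auto
    also have "\<dots> < int q ^ 6" by (simp add: q)
    finally show "int q ^ fermat_depth q b < int q ^ 6" .
  qed (use q in simp)
  ultimately show False using contradiction_of_depths[of 2 6] q by simp
qed

lemma four_dvd_k:
  assumes "\<not> 2 ^ (q - 1) dvd b - 1" "\<not> 2 ^ (q - 1) dvd b + 1"
  shows "4 dvd k"
  using two_power_dvd_exponent[of 2] assms q_ge by simp

text \<open>The source of the exceptional pairs for 11 and 13: \<open>b + 1 < 2 ^ q\<close> leaves
  room for a single positive multiple.\<close>

lemma dvd_pow_pred_cases: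
  assumes "2 ^ (q - 1) dvd b - 1 \<or> 2 ^ (q - 1) dvd b + 1"
  shows "b = 2 ^ (q - 1) + 1 \<or> b = 2 ^ (q - 1) - 1"
proof -
  have two: "(2::int) ^ q = 2 * 2 ^ (q - 1)" using q_ge by (simp add: power_eq_if)
  have "z = 2 ^ (q - 1)" if z: "2 ^ (q - 1) dvd z" "0 < z" "z < 2 ^ q" for z :: int
  proof -
    obtain t where t: "z = 2 ^ (q - 1) * t" using z(1) by auto
    have "0 < t" using z(2) by (simp add: t zero_less_mult_iff)
    moreover have "t < 2" using z(3) unfolding two t by simp
    ultimately show ?thesis using t by simp
  qed
  from this[of "b - 1"] this[of "b + 1"] show ?thesis using assms b_ge b_less by auto
qed

lemma q_eq_11:
  assumes q: "q = 11"
  shows "b \<in> {1023, 1025}"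
proof (rule ccontr)
  assume b: "b \<notin> {1023, 1025}"
  have bl: "b \<le> 2046" using b_less q by simp
  have "4 dvd k" using four_dvd_k dvd_pow_pred_cases b q by auto
  have "5 ^ 1 dvd k"
  proof (rule prime_power_dvd_exponent)
    have "fermat_depth 5 2 < 2" by (rule fermat_depth_less) simp
    moreover have "fermat_depth 5 b < 10"
    proof (rule fermat_depth_less_of_bound)
      have "b ^ 2 \<le> 2046 ^ 2" using bl b_ge by (intro power_mono) auto
      thus "2 * b ^ ((5 - 1) div 2) < int 5 ^ 10" by simp
    qed (use b_ge in auto)
    ultimately show "fermat_depth 5 2 + fermat_depth 5 b + 2 * (1 - 1) < q" using q by linarith
  qed (use \<open>4 dvd k\<close> in auto)
  hence "2 * 5 dvd k" using even_k by (intro divides_mult) auto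
  \<comment> \<open>The check alone bounds the sum of the depths by 14; the exact depth of 2 lowers
    this to 8.\<close>
  moreover have "fermat_depth q 2 < 2" unfolding q by (rule fermat_depth_less) simp
  moreover have "fermat_depth q b < 8"
    using teichmueller_check_imp_not_dvd[OF _ check_small(2), of b] prime_q b_ge bl unfolding q
    by (intro fermat_depth_less) simp
  ultimately show False using contradiction_of_depths[of 2 8] q by simp
qed

lemma q_eq_13:
  assumes q: "q = 13"
  shows "b \<in> {4095, 4097}"
proof (rule ccontr)
  assume b: "b \<notin> {4095, 4097}"
  have bl: "b \<le> 8190" using b_less q by simp
  have "4 dvd k" using four_dvd_k dvd_pow_pred_cases b q by auto
  moreover have "3 ^ 1 dvd k" by (rule three_depths[of 9]) (use bl q in auto)
  ultimately have "12 dvd k" unfolding power_one_right by presburger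
  thus False using depth_sum_ge depth_sum_le_of_check[OF _ check_small(3), of b] prime_q b_ge bl q by simp
qed

text \<open>As \<open>q - 1 = 16\<close>, only the power of 2 in \<open>k\<close> matters. For
  \<open>v = 4\<close> it can fail only if \<open>2 ^ 14\<close> divides \<open>b - 1\<close> or
  \<open>b + 1\<close>, and both are below \<open>2 ^ 17\<close>.\<close>

lemma q_eq_17:
  assumes q: "q = 17" and "b \<le> 10 ^ 6"
  shows "\<exists>t\<in>{1, 2, 3, 4, 5, 6, 7}. b = t * 2 ^ 14 + 1 \<or> b = t * 2 ^ 14 - 1"
proof (rule ccontr)
  assume ex: "\<not> ?thesis"
  have mult: "\<exists>t\<in>{1, 2, 3, 4, 5, 6, 7}. z = t * 2 ^ 14" if z: "2 ^ 14 dvd z" "0 < z" "z < 2 ^ 17" for z :: int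
  proof -
    obtain t where t: "z = 2 ^ 14 * t" using z(1) by auto
    have "0 < t" "t < 8" using z(2,3) by (simp_all add: t)
    hence "t \<in> {1, 2, 3, 4, 5, 6, 7}" by auto
    thus ?thesis using t by (intro bexI[of _ t]) auto
  qed
  have "\<not> 2 ^ 14 dvd b - 1" using mult[of "b - 1"] ex b_ge b_less q by fastforce
  moreover have "\<not> 2 ^ 14 dvd b + 1" using mult[of "b + 1"] ex b_ge b_less q by fastforce
  ultimately have "16 dvd k" using two_power_dvd_exponent[of 4] q by simp
  thus False using depth_sum_ge depth_sum_le_of_check[OF _ check_small(4), of b] prime_q b_ge assms(2) q by simp
qed

lemma q_not_19:
  assumes "b \<le> 10 ^ 6"
  shows "q \<noteq> 19"
proof
  assume q: "q = 19"
  have "3 ^ 2 dvd k" by (rule three_depths[of 14]) (use assms q in auto)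
  hence "2 * 9 dvd k" using even_k by (intro divides_mult) auto
  thus False using depth_sum_ge depth_sum_le_of_check[OF _ check_small(5), of b] prime_q b_ge assms q by simp
qed

lemma q_cases:
  assumes "b \<le> 10 ^ 6"
  shows "q = 5 \<or> q = 11 \<or> q = 13 \<or> q = 17"
proof -
  have "\<not> 3 dvd q" using prime_q q_not_3 primes_dvd_imp_eq[of 3 q] by auto
  moreover have "q = 3 \<or> q = 5 \<or> q = 7 \<or> q = 9 \<or> q = 11 \<or> q = 13 \<or> q = 15 \<or> q = 17 \<or> q = 19 \<or> q = 21"
    using q_ge q_less_23[OF assms] odd_q by presburger
  ultimately show ?thesis using q_not_3 q_not_7 q_not_19[OF assms] by fastforce
qed

end

section \<open>From the logarithmic bound to the excepted pairs\<close>

theorem theorem3: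
  fixes b :: int and q :: nat
  assumes "odd b" and "3 \<le> b" and "b \<le> 10 ^ 6"
    and "prime q" and "odd q"
    and "real q > log 2 (real_of_int b + 1)"
    and "\<not> (q = 5 \<and> b \<in> {15, 17})"
    and "\<not> (q = 11 \<and> b \<in> {1023, 1025})"
    and "\<not> (q = 13 \<and> b \<in> {4095, 4097})"
    and "\<not> (q = 17 \<and> (\<exists>t\<in>{1, 2, 3, 4, 5, 6, 7}. b = t * 2 ^ 14 + 1 \<or> b = t * 2 ^ 14 - 1))"
  shows "\<not> (\<exists>(k :: nat) (y :: int). k \<ge> 2 \<and> y \<ge> 2 \<and> (2 ^ k - 1) * (b ^ k - 1) = y ^ q)"
proof
  assume "\<exists>(k :: nat) (y :: int). k \<ge> 2 \<and> y \<ge> 2 \<and> (2 ^ k - 1) * (b ^ k - 1) = y ^ q"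
  then obtain k :: nat and y :: int
    where ky: "2 \<le> k" "2 \<le> y" "(2 ^ k - 1) * (b ^ k - 1) = y ^ q" by blast
  have "real_of_int b + 1 < 2 powr real q"
    using assms(2,6) by (simp add: log_less_iff)
  hence "real_of_int (b + 1) < real_of_int (2 ^ q)" by (simp add: powr_realpow)
  hence "b + 1 < 2 ^ q" by (simp only: of_int_less_iff)
  then interpret solution b y k q
    using assms(1,2,4,5) ky by unfold_locales auto
  show False
    using q_cases[OF assms(3)] q_eq_5 q_eq_11 q_eq_13 q_eq_17[OF _ assms(3)] assms(7-10) by blast
qed

end
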